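(* Let $\xi$ and $\eta$ be independent compound Poisson processes such that $0\notin\mathrm{supp}(\nu_\eta)$, $0\notin\mathrm{supp}(\nu_\xi)$ and $\nu_\xi(\mathbb R_+)=0$. Let $q\in(0,\infty)$, let $\tau$ be exponentially distributed with parameter $q$ and independent of $(\xi,\eta)$, and let $V=\int_0^\tau e^{-\xi_{s-}}\,d\eta_s$. (Recall that $\mathrm{supp}(\eta_\tau)=\overline{\{\sum_{j=1}^n b_j: b_j\in\mathrm{supp}(\nu_\eta),\ n\in\mathbb N_0\}}$.) (i) Assume there are $\beta<\alpha<0$ such that $[\beta,\alpha]\subseteq\mathrm{supp}(\nu_\xi)$ and set $k:=\lfloor\frac{\alpha}{\beta-\alpha}\rfloor+1$. Then $$\mathrm{supp}(V)\supseteq\begin{cases}\mathrm{supp}(\eta_\tau)\cup[e^{-k\alpha}\inf\mathrm{supp}(\nu_\eta),\infty), & \text{if }\eta\text{ is a subordinator},\\ \mathrm{supp}(\eta_\tau)\cup(-\infty,e^{-k\alpha}\sup\mathrm{supp}(\nu_\eta)], & \text{if }-\eta\text{ is a subordinator},\\ \mathbb R, & \text{otherwise.}\end{cases}$$ (ii) Assume $\eta$ is a subordinator and there are $0<\alpha<\beta$ such that $[\alpha,\beta]\subseteq\mathrm{supp}(\nu_\eta)$. Set $k:=\lfloor\frac{\alpha}{\beta-\alpha}\rfloor+1$. Then $$\mathrm{supp}(V)\supseteq\begin{cases}\{0\}\cup[\alpha,\infty), & \text{if }\ln(\beta/\alpha)\ge-\sup\mathrm{supp}(\nu_\xi),\\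 \{0\}\cup\bigcup_{\ell=1}^{k-1}[\ell\alpha,\ell\beta]\cup[k\alpha,\infty), & \text{otherwise.}\end{cases}$$ (iii) Assume $-\eta$ is a subordinator and there are $\beta<\alpha<0$ such that $[\beta,\alpha]\subseteq\mathrm{supp}(\nu_\eta)$. Set $k:=\lfloor\frac{\alpha}{\beta-\alpha}\rfloor+1$. Then $$\mathrm{supp}(V)\supseteq\begin{cases}(-\infty,\alpha]\cup\{0\}, & \text{if }\ln(\beta/\alpha)\ge-\sup\mathrm{supp}(\nu_\xi),\\ (-\infty,k\alpha]\cup\bigcup_{\ell=1}^{k-1}[\ell\beta,\ell\alpha]\cup\{0\}, & \text{otherwise.}\end{cases}$$ (iv) Assume $\nu_\eta(\mathbb R_-)\ne0\ne\nu_\eta(\mathbb R_+)$, and there are $0<\alpha<\beta$ such that $[\alpha,\beta]\subseteq\mathrm{supp}(\nu_\eta)$ or $\beta<\alpha<0$ such that $[\beta,\alpha]\subseteq\mathrm{supp}(\nu_\eta)$. Then $\mathrm{supp}(V)=\mathbb R$. (v) Assume $\nu_\eta(\mathbb R_-)\neq0\ne\nu_\eta(\mathbb R_+)$ and that there are numbers $z_1<0$, $z_2>0$ in $\mathrm{supp}(\nu_\eta)$ such that $z_2/z_1$ is irrational. Then $\mathrm{supp}(V)=\mathbb R$.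
   Context: $\nu_L$ denotes the Lévy measure of a Lévy process $L$ (with $\nu_L(\{0\})=0$). A compound Poisson process is a Lévy process with finite non-zero Lévy measure, no Gaussian part and zero drift. A subordinator is a Lévy process with nondecreasing paths. $\mathbb R_+=[0,\infty)$, $\mathbb R_-=(-\infty,0]$; $\lfloor x\rfloor$ is the floor function; $\mathrm{supp}$ is the closed topological support of a measure or of the law of a random variable. *)

theory Defs
  imports "HOL-Probability.Probability"
begin

definition measure_support :: "'a::topological_space measure \<Rightarrow> 'a set" where
  "measure_support \<mu> = {x. \<forall>U. open U \<longrightarrow> x \<in> U \<longrightarrow> emeasure \<mu> U \<noteq> 0}"

section \<open>Levy processes\<close>

text \<open>Processes are indexed by \<^typ>\<open>real\<close>; only their values at times \<open>t \<ge> 0\<close> matter.\<close>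

definition left_limit :: "(real \<Rightarrow> real) \<Rightarrow> real \<Rightarrow> real" where
  "left_limit f s = Lim (at_left s) f"

definition cadlag :: "(real \<Rightarrow> real) \<Rightarrow> bool" where
  "cadlag f \<longleftrightarrow>
     (\<forall>t\<ge>0. continuous (at_right t) f) \<and> (\<forall>t>0. \<exists>l. (f \<longlongrightarrow> l) (at_left t))"

text \<open>Stochastic continuity is not listed separately: it follows from almost surely cadlag paths
  and stationarity of the increments.\<close>

definition levy_process :: "'a measure \<Rightarrow> (real \<Rightarrow> 'a \<Rightarrow> real) \<Rightarrow> bool" where
  "levy_process M L \<longleftrightarrow>
     prob_space M \<and>
     (\<forall>t\<ge>0. L t \<in> borel_measurable M) \<and>
     (AE \<omega> in M. L 0 \<omega> = 0) \<and>
     (\<forall>(n::nat) (t :: nat \<Rightarrow> real). 0 \<le> t 0 \<longrightarrow> (\<forall>i<n. t i \<le> t (Suc i)) \<longrightarrow>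
        prob_space.indep_vars M (\<lambda>_. borel) (\<lambda>i \<omega>. L (t (Suc i)) \<omega> - L (t i) \<omega>) {..<n}) \<and>
     (\<forall>s\<ge>0. \<forall>t\<ge>0. distr M borel (\<lambda>\<omega>. L (s + t) \<omega> - L s \<omega>) = distr M borel (L t)) \<and>
     (AE \<omega> in M. cadlag (\<lambda>t. L t \<omega>))"

definition subordinator :: "'a measure \<Rightarrow> (real \<Rightarrow> 'a \<Rightarrow> real) \<Rightarrow> bool" where
  "subordinator M L \<longleftrightarrow> levy_process M L \<and> (AE \<omega> in M. mono_on {0..} (\<lambda>t. L t \<omega>))"

definition levy_measure :: "real measure \<Rightarrow> bool" where
  "levy_measure \<nu> \<longleftrightarrow>
     sets \<nu> = sets borel \<and> emeasure \<nu> {0} = 0 \<and> integrable \<nu> (\<lambda>x. min 1 (x\<^sup>2))"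

text \<open>The exponent in the Levy-Khintchine formula, with truncation function \<open>x 1{|x| \<le> 1}\<close>;
  \<open>A\<close> is the Gaussian variance.\<close>

definition levy_khintchine_exponent ::
    "real \<Rightarrow> real measure \<Rightarrow> real \<Rightarrow> real \<Rightarrow> complex" where
  "levy_khintchine_exponent A \<nu> \<gamma> u =
     \<i> * complex_of_real (\<gamma> * u) - complex_of_real (A * u\<^sup>2 / 2) +
     (CLINT x|\<nu>. iexp (u * x) - 1 - \<i> * complex_of_real (u * x * indicator {-1..1} x))"

definition characteristic_triplet ::
    "'a measure \<Rightarrow> (real \<Rightarrow> 'a \<Rightarrow> real) \<Rightarrow> real \<Rightarrow> real measure \<Rightarrow> real \<Rightarrow> bool" where
  "characteristic_triplet M L A \<nu> \<gamma> \<longleftrightarrow>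
     levy_process M L \<and> A \<ge> 0 \<and> levy_measure \<nu> \<and>
     (\<forall>t\<ge>0. \<forall>u. char (distr M borel (L t)) u =
        exp (complex_of_real t * levy_khintchine_exponent A \<nu> \<gamma> u))"

text \<open>The drift of a triplet \<open>(A, \<nu>, \<gamma>)\<close>; meaningful if \<open>\<nu>\<close> integrates \<open>|x| 1{|x| \<le> 1}\<close>,
  in particular if \<open>\<nu>\<close> is finite.\<close>

definition levy_drift :: "real measure \<Rightarrow> real \<Rightarrow> real" where
  "levy_drift \<nu> \<gamma> = \<gamma> - (LINT x:{-1..1}|\<nu>. x)"

text \<open>\<open>L\<close> is a compound Poisson process and \<open>\<nu>\<close> is its Levy measure.\<close>

definition compound_poisson ::
    "'a measure \<Rightarrow> (real \<Rightarrow> 'a \<Rightarrow> real) \<Rightarrow> real measure \<Rightarrow> bool" where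
  "compound_poisson M L \<nu> \<longleftrightarrow>
     finite_measure \<nu> \<and> emeasure \<nu> UNIV \<noteq> 0 \<and>
     (\<exists>\<gamma>. characteristic_triplet M L 0 \<nu> \<gamma> \<and> levy_drift \<nu> \<gamma> = 0)"

definition sample_path :: "(real \<Rightarrow> 'a \<Rightarrow> real) \<Rightarrow> 'a \<Rightarrow> real \<Rightarrow> real" where
  "sample_path L \<omega> = (\<lambda>t\<in>{0..}. L t \<omega>)"

abbreviation path_space :: "(real \<Rightarrow> real) measure" where
  "path_space \<equiv> PiM {0..} (\<lambda>_. borel)"

section \<open>Pathwise Lebesgue-Stieltjes integrals\<close>

text \<open>The integral of \<open>f\<close> over \<open>(a, b]\<close> against \<open>g\<close>, where \<open>g\<close> is right-continuous and of
  bounded variation on \<open>[a, b]\<close>, i.e. a difference of two nondecreasing right-continuous functions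
  there. The value does not depend on the decomposition. Almost every path of a compound Poisson
  process is such a \<open>g\<close> on every \<open>[0, b]\<close>, so the stochastic integral against it is this pathwise one.\<close>

definition has_stieltjes_integral ::
    "(real \<Rightarrow> real) \<Rightarrow> (real \<Rightarrow> real) \<Rightarrow> real \<Rightarrow> real \<Rightarrow> real \<Rightarrow> bool" where
  "has_stieltjes_integral f g a b I \<longleftrightarrow>
     (\<exists>F G. mono F \<and> mono G \<and>
        (\<forall>x. continuous (at_right x) F) \<and> (\<forall>x. continuous (at_right x) G) \<and>
        (\<forall>x\<in>{a..b}. g x = F x - G x) \<and>
        set_integrable (interval_measure F) {a<..b} f \<and>
        set_integrable (interval_measure G) {a<..b} f \<and>
        I = (LINT x:{a<..b}|interval_measure F. f x) - (LINT x:{a<..b}|interval_measure G. f x))"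

definition stieltjes_integral ::
    "(real \<Rightarrow> real) \<Rightarrow> (real \<Rightarrow> real) \<Rightarrow> real \<Rightarrow> real \<Rightarrow> real" where
  "stieltjes_integral f g a b = (THE I. has_stieltjes_integral f g a b I)"

end

theory Submission
  imports Defs
begin

text \<open>
  Since \<open>\<xi>\<close> and \<open>\<eta>\<close> do not jump together, \<open>V\<close> is the sum of the jumps of \<open>\<eta>\<close> before \<open>\<tau>\<close>, each multiplied by
  \<open>exp (- \<xi>)\<close> at its time. The jumps of the two processes can come in any order and with any sizes close
  to points of the supports of the Levy measures. Hence the closed set \<open>supp(V)\<close> contains \<open>0\<close>, and with
  \<open>v\<close> also \<open>b + v\<close> and \<open>exp (- a) v\<close> for all \<open>b\<close> in the support of \<open>\<nu>\<^sub>\<eta>\<close> and \<open>a\<close> in that of \<open>\<nu>\<^sub>\<xi>\<close> (as far as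
  \<open>v\<close> was obtained in this way). All five parts follow from this by elementary geometry: multiples
  of an interval eventually overlap (\<open>interval_multiples_cover\<close>), the images of an interval under repeated
  scaling have no gaps if the factor is small enough (\<open>scale_into_interval\<close>), jumps of both signs move any
  target into a half-line, and two jumps with irrational ratio and opposite signs generate a dense
  semigroup by Kronecker's theorem. The points of \<open>supp(\<eta>\<^sub>\<tau>)\<close> are limits of values of \<open>V\<close> on the event that
  \<open>\<xi>\<close> rests; they lie in the support of \<open>\<eta>\<^sub>1\<close>, because the null sets of \<open>\<eta>\<^sub>t\<close> do not depend on \<open>t > 0\<close>
  (\<open>support_at_random_time\<close>).

  The probabilistic part is \<open>discounted_sum_in_support\<close>. It avoids a description of the jump times. Time is
  cut into unit intervals in which \<open>\<eta>\<close> and \<open>\<xi>\<close> move in turns while the other one rests, and \<open>\<tau>\<close> falls into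
  a final interval of rest. On such paths the Stieltjes integral only depends on the increments of the
  processes over the unit intervals, so two facts about one-dimensional laws suffice: resting has positive
  probability, and increments over a unit interval come close to any point of the support of the Levy
  measure. Both are read off from the representation of the laws as Poisson mixtures of convolution powers
  (\<open>compound_poisson_distr\<close>), which follows from the characteristic function.

  That the pathwise integral exists at all uses that almost every path is a step function. The number of
  changes along dyadic grids has bounded expectation (\<open>AE_bounded_changes\<close>), and a right-continuous function
  whose number of changes on each bounded interval is bounded over all dyadic grids is a step function
  (\<open>locally_step_if_bounded_changes\<close>).
\<close>

section \<open>The one-dimensional laws of a compound Poisson process\<close>

fun conv_power :: "real measure \<Rightarrow> nat \<Rightarrow> real measure" where
  "conv_power \<mu> 0 = return borel 0"
| "conv_power \<mu> (Suc n) = (\<mu> \<star> conv_power \<mu> n)"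

lemma real_distribution_convolution:
  assumes "real_distribution M" "real_distribution N"
  shows "real_distribution (M \<star> N)"
proof -
  interpret M: real_distribution M by fact
  interpret N: real_distribution N by fact
  interpret pair_prob_space M N ..
  show ?thesis
    unfolding convolution_def
    by (rule real_distribution_distr) simp
qed

lemma char_convolution:
  assumes "real_distribution M" "real_distribution N"
  shows "char (M \<star> N) t = char M t * char N t"
proof -
  interpret M: real_distribution M by fact
  interpret N: real_distribution N by fact
  interpret P: pair_prob_space M N ..
  have "char (M \<star> N) t = (CLINT p|(M \<Otimes>\<^sub>M N). iexp (t * (fst p + snd p)))"
    unfolding char_def convolution_def by (subst integral_distr) (auto simp: case_prod_beta)
  also have "\<dots> = (CLINT x|M. (CLINT y|N. iexp (t * (x + y))))"
    by (subst P.integral_fst'[symmetric])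
       (auto simp: case_prod_beta intro!: P.integrable_const_bound[where B=1])
  also have "\<dots> = (CLINT x|M. iexp (t * x) * (CLINT y|N. iexp (t * y)))"
    by (simp add: ring_distribs exp_add)
  also have "\<dots> = char M t * char N t"
    by (simp add: char_def)
  finally show ?thesis .
qed

lemma conv_power_distribution:
  assumes "real_distribution \<mu>"
  shows "real_distribution (conv_power \<mu> n)"
proof (induction n)
  case 0
  show ?case
    by (auto simp: real_distribution_def real_distribution_axioms_def intro!: prob_space_return)
next
  case (Suc n)
  then show ?case using real_distribution_convolution[OF assms] by simp
qed

lemma char_conv_power:
  assumes "real_distribution \<mu>"
  shows "char (conv_power \<mu> n) t = char \<mu> t ^ n"
proof (induction n)
  case 0
  then show ?case by (simp add: char_def integral_return)
next
  case (Suc n)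
  then show ?case
    by (simp add: char_convolution[OF assms conv_power_distribution[OF assms]])
qed

lemma emeasure_conv_power_Suc_0:
  assumes "real_distribution \<mu>" "A \<in> sets borel"
  shows "emeasure (conv_power \<mu> (Suc 0)) A = emeasure \<mu> A"
proof -
  have "conv_power \<mu> (Suc 0) = \<mu>"
    using assms(1) conv_power_distribution[OF assms(1)]
    by (intro Levy_uniqueness ext) (simp_all add: char_conv_power del: conv_power.simps)
  then show ?thesis by simp
qed

text \<open>With \<open>A = [0, \<infinity>)\<close> and \<open>A = (-\<infinity>, 0]\<close> this carries the sign of the jumps over to the process.\<close>

lemma AE_conv_power_in:
  assumes "real_distribution \<mu>" and A[measurable]: "A \<in> sets borel"
    and "0 \<in> A" and add: "\<And>x y. x \<in> A \<Longrightarrow> y \<in> A \<Longrightarrow> x + y \<in> A"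
    and "AE x in \<mu>. x \<in> A"
  shows "AE x in conv_power \<mu> n. x \<in> A"
proof (induction n)
  case 0
  show ?case unfolding conv_power.simps by (subst AE_return) (use assms in auto)
next
  case (Suc n)
  interpret M: real_distribution \<mu> by fact
  interpret N: real_distribution "conv_power \<mu> n" by (rule conv_power_distribution) fact
  interpret P: pair_prob_space \<mu> "conv_power \<mu> n" ..
  have "AE p in \<mu> \<Otimes>\<^sub>M conv_power \<mu> n. fst p + snd p \<in> A"
  proof (rule P.AE_pair_measure)
    show "{x \<in> space (\<mu> \<Otimes>\<^sub>M conv_power \<mu> n). fst x + snd x \<in> A} \<in> sets (\<mu> \<Otimes>\<^sub>M conv_power \<mu> n)"
      by measurable
    show "AE x in \<mu>. AE y in conv_power \<mu> n. fst (x, y) + snd (x, y) \<in> A"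
      using assms(5)
    proof eventually_elim
      case (elim x)
      from Suc.IH show ?case
        by eventually_elim (use elim add in auto)
    qed
  qed
  then show ?case
    unfolding conv_power.simps convolution_def by (subst AE_distr_iff) (auto simp: case_prod_beta)
qed

definition compound_poisson_law :: "real \<Rightarrow> real measure \<Rightarrow> real measure" where
  "compound_poisson_law r \<mu> = measure_pmf (poisson_pmf r) \<bind> conv_power \<mu>"

lemma conv_power_kernel:
  assumes "real_distribution \<mu>"
  shows "conv_power \<mu> \<in> measurable (measure_pmf p) (subprob_algebra borel)"
proof -
  have "conv_power \<mu> n \<in> space (subprob_algebra borel)" for n
  proof -
    interpret real_distribution "conv_power \<mu> n" by (rule conv_power_distribution) fact
    show ?thesis using subprob_space_axioms by (simp add: space_subprob_algebra)
  qed
  then show ?thesis by auto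
qed

lemma real_distribution_compound_poisson_law:
  assumes "real_distribution \<mu>"
  shows "real_distribution (compound_poisson_law r \<mu>)"
proof -
  interpret prob_space "compound_poisson_law r \<mu>"
    unfolding compound_poisson_law_def
  proof (rule measure_pmf.prob_space_bind)
    show "conv_power \<mu> \<in> measurable (measure_pmf (poisson_pmf r)) (subprob_algebra borel)"
      by (rule conv_power_kernel) fact
    show "AE n in measure_pmf (poisson_pmf r). prob_space (conv_power \<mu> n)"
      using conv_power_distribution[OF assms] by (simp add: real_distribution_def)
  qed
  have "sets (compound_poisson_law r \<mu>) = sets borel"
    unfolding compound_poisson_law_def
    using conv_power_distribution[OF assms]
    by (intro sets_bind) (auto simp: real_distribution_def real_distribution_axioms_def)
  then show ?thesis
    by (intro real_distribution.intro real_distribution_axioms.intro prob_space_axioms)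
qed

text \<open>The probability generating function of the Poisson law.\<close>

lemma integral_poisson_pmf:
  fixes z :: complex
  assumes "r > 0" "norm z \<le> 1"
  shows "integrable (measure_pmf (poisson_pmf r)) (\<lambda>n. z ^ n)"
    and "(\<integral>n. z ^ n \<partial>measure_pmf (poisson_pmf r)) = exp (of_real r * (z - 1))"
proof -
  show int: "integrable (measure_pmf (poisson_pmf r)) (\<lambda>n. z ^ n)"
    using assms by (intro measure_pmf.integrable_const_bound[where B=1])
      (auto simp: norm_power power_le_one)
  let ?f = "\<lambda>n. (r ^ n / fact n * exp (- r)) *\<^sub>R z ^ n"
  have int': "integrable (count_space UNIV) ?f"
    using int unfolding measure_pmf_eq_density
    by (subst (asm) integrable_density) (use assms in auto)
  have "(\<integral>n. z ^ n \<partial>measure_pmf (poisson_pmf r)) = (\<integral>n. ?f n \<partial>count_space UNIV)"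
    unfolding measure_pmf_eq_density
    by (subst integral_density) (use assms in auto)
  also have "\<dots> = (\<Sum>n. ?f n)" by (rule integral_count_space_nat[OF int'])
  also have "\<dots> = exp (of_real r * (z - 1))"
  proof (rule sums_unique[symmetric])
    have "(\<lambda>n. exp (- of_real r) * ((of_real r * z) ^ n /\<^sub>R fact n)) sums
        (exp (- of_real r) * exp (of_real r * z))"
      by (intro sums_mult exp_converges)
    moreover have "exp (- of_real r) * ((of_real r * z) ^ n /\<^sub>R fact n) = ?f n" for n
      by (simp add: power_mult_distrib field_simps scaleR_conv_of_real exp_of_real[symmetric])
    moreover have "exp (- of_real r) * exp (of_real r * z) = exp (of_real r * (z - 1))"
      by (simp add: mult_exp_exp algebra_simps)
    ultimately show "?f sums exp (of_real r * (z - 1))" by simp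
  qed
  finally show "(\<integral>n. z ^ n \<partial>measure_pmf (poisson_pmf r)) = exp (of_real r * (z - 1))" .
qed

lemma char_compound_poisson_law:
  assumes "real_distribution \<mu>" "r > 0"
  shows "char (compound_poisson_law r \<mu>) u = exp (of_real r * (char \<mu> u - 1))"
proof -
  interpret \<mu>: real_distribution \<mu> by fact
  interpret L: real_distribution "compound_poisson_law r \<mu>"
    by (rule real_distribution_compound_poisson_law) fact
  let ?P = "measure_pmf (poisson_pmf r)"
  \<comment> \<open>The mixture formula is needed for real and imaginary part separately, that is, for \<open>cos\<close> and \<open>sin\<close>.\<close>
  have swap: "(\<integral>x. f x \<partial>compound_poisson_law r \<mu>) = (\<integral>n. (\<integral>x. f x \<partial>conv_power \<mu> n) \<partial>?P)"
    if [measurable]: "f \<in> borel_measurable borel" and "\<And>x. \<bar>f x\<bar> \<le> 1" for f :: "real \<Rightarrow> real"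
  proof -
    have "emeasure (conv_power \<mu> n) (space (conv_power \<mu> n)) \<le> ennreal 1" for n
      using conv_power_distribution[OF assms(1), of n]
      by (auto simp: real_distribution_def prob_space.emeasure_space_1)
    then show ?thesis
      unfolding compound_poisson_law_def
      by (intro integral_bind[where K=borel and B=1 and B'=1] conv_power_kernel assms)
         (use that in \<open>auto intro: measure_pmf.finite_measure\<close>)
  qed
  have int: "integrable N (\<lambda>x. iexp (u * x))" if "real_distribution N" for N
  proof -
    interpret real_distribution N by fact
    show ?thesis by (intro integrable_const_bound[where B=1]) auto
  qed
  have Re: "Re (char N u) = (\<integral>x. cos (u * x) \<partial>N)" and Im: "Im (char N u) = (\<integral>x. sin (u * x) \<partial>N)"
    if "real_distribution N" for N
    using int[OF that] by (simp_all add: char_def integral_Re[symmetric] integral_Im[symmetric] Re_exp Im_exp del: integral_Re integral_Im)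
  have P: "integrable ?P (\<lambda>n. char \<mu> u ^ n)"
    "(\<integral>n. char \<mu> u ^ n \<partial>?P) = exp (of_real r * (char \<mu> u - 1))"
    using integral_poisson_pmf[OF assms(2) \<mu>.cmod_char_le_1] by auto
  have "char (compound_poisson_law r \<mu>) u = (\<integral>n. char \<mu> u ^ n \<partial>?P)"
  proof (rule complex_eqI)
    have "Re (char (compound_poisson_law r \<mu>) u) = (\<integral>n. Re (char (conv_power \<mu> n) u) \<partial>?P)"
      using conv_power_distribution[OF assms(1)] L.real_distribution_axioms
      by (simp add: Re swap)
    also have "\<dots> = Re (\<integral>n. char \<mu> u ^ n \<partial>?P)"
      using integral_Re[OF P(1)] by (simp add: char_conv_power assms)
    finally show "Re (char (compound_poisson_law r \<mu>) u) = Re (\<integral>n. char \<mu> u ^ n \<partial>?P)" .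
    have "Im (char (compound_poisson_law r \<mu>) u) = (\<integral>n. Im (char (conv_power \<mu> n) u) \<partial>?P)"
      using conv_power_distribution[OF assms(1)] L.real_distribution_axioms
      by (simp add: Im swap)
    also have "\<dots> = Im (\<integral>n. char \<mu> u ^ n \<partial>?P)"
      using integral_Im[OF P(1)] by (simp add: char_conv_power assms)
    finally show "Im (char (compound_poisson_law r \<mu>) u) = Im (\<integral>n. char \<mu> u ^ n \<partial>?P)" .
  qed
  with P(2) show ?thesis by simp
qed

text \<open>The \<open>n\<close>-th component of the mixture alone already contributes this much.\<close>

lemma emeasure_compound_poisson_law_ge:
  assumes "real_distribution \<mu>" "r > 0" "A \<in> sets borel"
  shows "ennreal (r ^ n / fact n * exp (- r)) * emeasure (conv_power \<mu> n) A
           \<le> emeasure (compound_poisson_law r \<mu>) A"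
proof -
  have "emeasure (compound_poisson_law r \<mu>) A
      = (\<integral>\<^sup>+k. emeasure (conv_power \<mu> k) A \<partial>measure_pmf (poisson_pmf r))"
    unfolding compound_poisson_law_def
    by (intro emeasure_bind[where N=borel] conv_power_kernel assms) auto
  moreover have "(\<integral>\<^sup>+k. emeasure (conv_power \<mu> n) A * indicator {n} k \<partial>measure_pmf (poisson_pmf r))
      \<le> (\<integral>\<^sup>+k. emeasure (conv_power \<mu> k) A \<partial>measure_pmf (poisson_pmf r))"
    by (intro nn_integral_mono) (auto simp: indicator_def)
  ultimately show ?thesis
    using assms(2) by (simp add: nn_integral_cmult emeasure_pmf_single mult.commute[of _ "emeasure _ _"])
qed

text \<open>Every component of the mixture has positive weight, whatever the positive rate. The null sets of
  the law therefore do not depend on the rate.\<close>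

lemma emeasure_compound_poisson_law_0_iff:
  assumes "real_distribution \<mu>" "r > 0" "A \<in> sets borel"
  shows "emeasure (compound_poisson_law r \<mu>) A = 0 \<longleftrightarrow> (\<forall>n. emeasure (conv_power \<mu> n) A = 0)"
proof -
  have "emeasure (compound_poisson_law r \<mu>) A
      = (\<integral>\<^sup>+k. emeasure (conv_power \<mu> k) A \<partial>measure_pmf (poisson_pmf r))"
    unfolding compound_poisson_law_def
    by (intro emeasure_bind[where N=borel] conv_power_kernel assms) auto
  also have "\<dots> = 0 \<longleftrightarrow> (\<forall>n. emeasure (conv_power \<mu> n) A = 0)"
    using assms(2) by (subst nn_integral_0_iff_AE) (auto simp: AE_measure_pmf_iff)
  finally show ?thesis .
qed

lemma real_distribution_normalize:
  assumes "finite_measure \<nu>" "sets \<nu> = sets borel" "emeasure \<nu> UNIV \<noteq> 0"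
  shows "real_distribution (density \<nu> (\<lambda>_. ennreal (1 / measure \<nu> UNIV)))"
proof -
  interpret finite_measure \<nu> by fact
  have sp: "space \<nu> = UNIV" using sets_eq_imp_space_eq[OF assms(2)] by simp
  have "measure \<nu> UNIV > 0"
    using assms(3) by (simp add: emeasure_eq_measure zero_less_measure_iff)
  then have "emeasure (density \<nu> (\<lambda>_. ennreal (1 / measure \<nu> UNIV))) UNIV = 1"
    by (subst emeasure_density_const)
       (auto simp: emeasure_eq_measure ennreal_mult[symmetric] sp[symmetric])
  then show ?thesis
    by (auto simp: real_distribution_def real_distribution_axioms_def assms(2) sp
        intro!: prob_spaceI)
qed

text \<open>Without Gaussian part and drift the Levy--Khintchine exponent is \<open>\<integral> (e\<^bsup>iux\<^esup> - 1) d\<nu>\<close>,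
  which is the exponent of a compound Poisson law; characteristic functions determine laws.\<close>

lemma compound_poisson_distr:
  assumes cp: "compound_poisson M L \<nu>" and t: "t > 0"
  shows "distr M borel (L t)
    = compound_poisson_law (t * measure \<nu> UNIV) (density \<nu> (\<lambda>_. ennreal (1 / measure \<nu> UNIV)))"
proof -
  let ?r = "measure \<nu> UNIV"
  let ?\<mu> = "density \<nu> (\<lambda>_. ennreal (1 / measure \<nu> UNIV))"
  from cp obtain \<gamma> where fin: "finite_measure \<nu>" and nz: "emeasure \<nu> UNIV \<noteq> 0"
    and tr: "characteristic_triplet M L 0 \<nu> \<gamma>" and drift: "levy_drift \<nu> \<gamma> = 0"
    by (auto simp: compound_poisson_def)
  from tr have levy: "levy_process M L" and s[measurable_cong]: "sets \<nu> = sets borel"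
    and ch: "\<And>u. char (distr M borel (L t)) u
               = exp (complex_of_real t * levy_khintchine_exponent 0 \<nu> \<gamma> u)"
    using t by (auto simp: characteristic_triplet_def levy_measure_def)
  interpret \<nu>: finite_measure \<nu> by fact
  have sp: "space \<nu> = UNIV" using sets_eq_imp_space_eq[OF s] by simp
  have rate: "?r > 0"
    using nz by (simp add: \<nu>.emeasure_eq_measure zero_less_measure_iff)
  interpret M: prob_space M using levy by (simp add: levy_process_def)
  have meas: "L t \<in> borel_measurable M" using levy t by (simp add: levy_process_def)
  have \<mu>: "real_distribution ?\<mu>" by (rule real_distribution_normalize) fact+
  have int1: "complex_integrable \<nu> (\<lambda>x. iexp (u * x))" for u
    by (intro \<nu>.integrable_const_bound[where B=1]) auto
  have int2: "integrable \<nu> (\<lambda>x. x * indicator {-1..1} x)"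
    by (intro \<nu>.integrable_const_bound[where B=1]) (auto simp: indicator_def)
  have char\<mu>: "char ?\<mu> u = (CLINT x|\<nu>. iexp (u * x)) / ?r" for u
    unfolding char_def
    by (subst integral_density) (use rate in \<open>auto simp: scaleR_conv_of_real\<close>)
  have \<gamma>: "\<gamma> = (LINT x|\<nu>. x * indicator {-1..1} x)"
    using drift by (simp add: levy_drift_def set_lebesgue_integral_def mult.commute)
  have exponent: "levy_khintchine_exponent 0 \<nu> \<gamma> u = ?r * (char ?\<mu> u - 1)" for u
  proof -
    have "complex_integrable \<nu> (\<lambda>x. \<i> * complex_of_real (u * (x * indicator {-1..1} x)))"
      by (intro integrable_mult_right integrable_of_real int2)
    moreover have "(CLINT x|\<nu>. \<i> * complex_of_real (u * (x * indicator {-1..1} x)))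
        = \<i> * complex_of_real (u * \<gamma>)"
      unfolding \<gamma> by (simp only: integral_mult_right_zero integral_complex_of_real)
    ultimately have "(CLINT x|\<nu>. iexp (u * x) - 1 - \<i> * complex_of_real (u * (x * indicator {-1..1} x)))
        = (CLINT x|\<nu>. iexp (u * x)) - ?r - \<i> * complex_of_real (u * \<gamma>)"
      using int1[of u] by (subst Bochner_Integration.integral_diff)
        (auto simp: sp scaleR_conv_of_real)
    then have "levy_khintchine_exponent 0 \<nu> \<gamma> u = (CLINT x|\<nu>. iexp (u * x)) - ?r"
      by (simp add: levy_khintchine_exponent_def mult.assoc)
    also have "\<dots> = ?r * (char ?\<mu> u - 1)"
      using rate by (simp add: char\<mu> right_diff_distrib)
    finally show ?thesis .
  qed
  show ?thesis
  proof (rule Levy_uniqueness)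
    show "real_distribution (distr M borel (L t))"
      by (rule M.real_distribution_distr) fact
    show "real_distribution (compound_poisson_law (t * ?r) ?\<mu>)"
      by (rule real_distribution_compound_poisson_law) fact
    show "char (distr M borel (L t)) = char (compound_poisson_law (t * ?r) ?\<mu>)"
      using rate t by (simp add: fun_eq_iff ch exponent char_compound_poisson_law \<mu> mult.assoc)
  qed
qed

lemma emeasure_normalize_0_iff:
  assumes "finite_measure \<nu>" "emeasure \<nu> UNIV \<noteq> 0" "A \<in> sets \<nu>"
  shows "emeasure (density \<nu> (\<lambda>_. ennreal (1 / measure \<nu> UNIV))) A = 0 \<longleftrightarrow> emeasure \<nu> A = 0"
proof -
  interpret finite_measure \<nu> by fact
  have "measure \<nu> UNIV > 0"
    using assms(2) by (simp add: emeasure_eq_measure zero_less_measure_iff)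
  then show ?thesis using assms(3) by (subst emeasure_density_const) auto
qed

text \<open>The bound is the weight of the component \<open>n = 0\<close>, the probability that no jump occurs up to time \<open>t\<close>.\<close>

lemma compound_poisson_prob_0_ge:
  assumes cp: "compound_poisson M L \<nu>" and t: "t > 0"
  shows "exp (- (t * measure \<nu> UNIV)) \<le> measure (distr M borel (L t)) {0}"
proof -
  have fin: "finite_measure \<nu>" and nz: "emeasure \<nu> UNIV \<noteq> 0" and s: "sets \<nu> = sets borel"
    using cp by (auto simp: compound_poisson_def characteristic_triplet_def levy_measure_def)
  interpret \<nu>: finite_measure \<nu> by fact
  have rate: "measure \<nu> UNIV > 0"
    using nz by (simp add: \<nu>.emeasure_eq_measure zero_less_measure_iff)
  let ?\<mu> = "density \<nu> (\<lambda>_. ennreal (1 / measure \<nu> UNIV))"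
  have \<mu>: "real_distribution ?\<mu>" by (rule real_distribution_normalize) fact+
  interpret R: real_distribution "compound_poisson_law (t * measure \<nu> UNIV) ?\<mu>"
    by (rule real_distribution_compound_poisson_law) fact
  have "ennreal (exp (- (t * measure \<nu> UNIV)))
        \<le> emeasure (compound_poisson_law (t * measure \<nu> UNIV) ?\<mu>) {0}"
    using emeasure_compound_poisson_law_ge[OF \<mu>, of "t * measure \<nu> UNIV" "{0}" 0] rate t
    by simp
  then show ?thesis
    unfolding compound_poisson_distr[OF cp t] by (simp add: R.emeasure_eq_measure)
qed

lemma compound_poisson_null_iff:
  assumes cp: "compound_poisson M L \<nu>" and "t > 0" "A \<in> sets borel"
  shows "emeasure (distr M borel (L t)) A = 0 \<longleftrightarrow>
    (\<forall>n. emeasure (conv_power (density \<nu> (\<lambda>_. ennreal (1 / measure \<nu> UNIV))) n) A = 0)"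
proof -
  have fin: "finite_measure \<nu>" and nz: "emeasure \<nu> UNIV \<noteq> 0" and s: "sets \<nu> = sets borel"
    using cp by (auto simp: compound_poisson_def characteristic_triplet_def levy_measure_def)
  interpret \<nu>: finite_measure \<nu> by fact
  have rate: "measure \<nu> UNIV > 0"
    using nz by (simp add: \<nu>.emeasure_eq_measure zero_less_measure_iff)
  show ?thesis
    unfolding compound_poisson_distr[OF cp assms(2)]
    using rate assms by (intro emeasure_compound_poisson_law_0_iff real_distribution_normalize fin s nz) auto
qed

lemma compound_poisson_null_time_indep:
  assumes "compound_poisson M L \<nu>" "s > 0" "t > 0" "A \<in> sets borel"
  shows "emeasure (distr M borel (L s)) A = 0 \<longleftrightarrow> emeasure (distr M borel (L t)) A = 0"
  using assms by (simp add: compound_poisson_null_iff)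

text \<open>With positive probability there is exactly one jump up to time \<open>t\<close>, and that jump has the normalised
  Levy measure as its law.\<close>

lemma levy_measure_null_if:
  assumes cp: "compound_poisson M L \<nu>" and "t > 0" and A: "A \<in> sets borel"
    and null: "emeasure (distr M borel (L t)) A = 0"
  shows "emeasure \<nu> A = 0"
proof -
  have fin: "finite_measure \<nu>" and nz: "emeasure \<nu> UNIV \<noteq> 0" and s: "sets \<nu> = sets borel"
    using cp by (auto simp: compound_poisson_def characteristic_triplet_def levy_measure_def)
  have "emeasure (density \<nu> (\<lambda>_. ennreal (1 / measure \<nu> UNIV))) A = 0"
    using compound_poisson_null_iff[OF cp \<open>t > 0\<close> A] null
      emeasure_conv_power_Suc_0[OF real_distribution_normalize[OF fin s nz] A] by metis
  then show ?thesis using emeasure_normalize_0_iff[OF fin nz] A s by simp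
qed

lemma compound_poisson_AE_in:
  assumes cp: "compound_poisson M L \<nu>" and t: "t > 0" and A: "A \<in> sets borel"
    and A0: "0 \<in> A" and add: "\<And>x y. x \<in> A \<Longrightarrow> y \<in> A \<Longrightarrow> x + y \<in> A"
    and null: "emeasure \<nu> (- A) = 0"
  shows "AE \<omega> in M. L t \<omega> \<in> A"
proof -
  have fin: "finite_measure \<nu>" and nz: "emeasure \<nu> UNIV \<noteq> 0" and s: "sets \<nu> = sets borel"
    and meas: "L t \<in> borel_measurable M"
    using cp t by (auto simp: compound_poisson_def characteristic_triplet_def levy_measure_def
        levy_process_def)
  let ?\<mu> = "density \<nu> (\<lambda>_. ennreal (1 / measure \<nu> UNIV))"
  have \<mu>: "real_distribution ?\<mu>" by (rule real_distribution_normalize) fact+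
  have cA: "- A \<in> sets borel" using A by (simp add: Compl_eq_Diff_UNIV)
  have "emeasure ?\<mu> (- A) = 0"
    using emeasure_normalize_0_iff[OF fin nz, of "- A"] null s cA by simp
  then have "AE x in ?\<mu>. x \<in> A"
    using cA s by (intro AE_I[where N="- A"]) auto
  then have AE: "AE x in conv_power ?\<mu> n. x \<in> A" for n
    using \<mu> A A0 add by (intro AE_conv_power_in) auto
  have "emeasure (conv_power ?\<mu> n) (- A) = 0" for n
  proof -
    interpret real_distribution "conv_power ?\<mu> n" by (rule conv_power_distribution[OF \<mu>])
    show ?thesis using AE[of n] cA by (subst (asm) AE_iff_measurable[where N="- A"]) auto
  qed
  then have "emeasure (distr M borel (L t)) (- A) = 0"
    using compound_poisson_null_iff[OF cp t cA] by simp
  then have "AE x in distr M borel (L t). x \<in> A"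
    using cA by (intro AE_I[where N="- A"]) auto
  then show ?thesis using meas A by (subst (asm) AE_distr_iff) auto
qed

section \<open>Step functions\<close>

text \<open>On \<open>[0, \<infinity>)\<close> this means: right-continuous, with finitely many jumps on bounded intervals, and constant
  in between. The local form suits the compactness arguments below; the values at negative arguments are
  not constrained.\<close>

definition locally_step :: "(real \<Rightarrow> 'b) \<Rightarrow> bool" where
  "locally_step f \<longleftrightarrow> (\<forall>x\<ge>0. \<exists>d>0. \<exists>l.
     (\<forall>y. 0 \<le> y \<longrightarrow> x - d < y \<longrightarrow> y < x \<longrightarrow> f y = l) \<and> (\<forall>y. x \<le> y \<longrightarrow> y < x + d \<longrightarrow> f y = f x))"

text \<open>The dyadic intervals of level \<open>m\<close> inside \<open>[0, x]\<close> whose ends carry different values, given by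
  their indices.\<close>

definition changes :: "(real \<Rightarrow> 'b) \<Rightarrow> nat \<Rightarrow> real \<Rightarrow> nat set" where
  "changes f m x = {j. real (j + 1) / 2 ^ m \<le> x \<and> f (real (j + 1) / 2 ^ m) \<noteq> f (real j / 2 ^ m)}"

lemma finite_changes: "finite (changes f m x)"
proof -
  have "changes f m x \<subseteq> {..nat \<lceil>x * 2 ^ m\<rceil>}"
  proof
    fix j assume "j \<in> changes f m x"
    then have "real (j + 1) \<le> x * 2 ^ m" by (simp add: changes_def field_simps)
    then show "j \<in> {..nat \<lceil>x * 2 ^ m\<rceil>}" by (simp; linarith)
  qed
  then show ?thesis by (rule finite_subset) simp
qed

lemma card_changes_mono: "x \<le> y \<Longrightarrow> card (changes f m x) \<le> card (changes f m y)"
  by (intro card_mono finite_changes) (auto simp: changes_def)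

text \<open>If the ends of a dyadic interval carry different values, then so do the ends of one of its halves.\<close>

lemma card_changes_Suc: "card (changes f m x) \<le> card (changes f (Suc m) x)"
proof (rule card_inj_on_le[OF _ _ finite_changes])
  let ?h = "\<lambda>j. if f (real (2 * j + 1) / 2 ^ Suc m) \<noteq> f (real (2 * j) / 2 ^ Suc m) then 2 * j else 2 * j + 1"
  show "inj_on ?h (changes f m x)"
    by (rule inj_on_inverseI[where g="\<lambda>j. j div 2"]) auto
  show "?h ` changes f m x \<subseteq> changes f (Suc m) x"
  proof (rule image_subsetI)
    fix j assume j: "j \<in> changes f m x"
    have eq: "real (2 * j) / 2 ^ Suc m = real j / 2 ^ m"
      "real (2 * j + 1 + 1) / 2 ^ Suc m = real (j + 1) / 2 ^ m"
      by (simp_all add: field_simps)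
    have le: "real (2 * j + 1) / 2 ^ Suc m \<le> real (j + 1) / 2 ^ m"
      by (simp add: field_simps)
    show "?h j \<in> changes f (Suc m) x"
      using j le eq unfolding changes_def by (auto simp del: of_nat_add of_nat_mult power_Suc)
  qed
qed

lemma dyadic_between:
  fixes u v :: real
  assumes "0 \<le> u" "u < v"
  obtains m i :: nat where "u < real i / 2 ^ m" "real i / 2 ^ m < v"
proof -
  obtain m where m: "1 / (v - u) < 2 ^ m" using real_arch_pow[of 2] by auto
  let ?i = "nat \<lfloor>u * 2 ^ m\<rfloor> + 1"
  have i: "real ?i = of_int \<lfloor>u * 2 ^ m\<rfloor> + 1" using assms by simp
  have "u * 2 ^ m < real ?i" unfolding i by linarith
  moreover have "real ?i \<le> u * 2 ^ m + 1" unfolding i by linarith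
  moreover have "u * 2 ^ m + 1 < v * 2 ^ m" using m assms by (simp add: field_simps)
  ultimately show ?thesis using that[of ?i m] by (simp add: field_simps)
qed

lemma dyadic_refine:
  assumes "m \<le> n"
  shows "real i / 2 ^ m = real (i * 2 ^ (n - m)) / 2 ^ n"
  using assms by (simp add: field_simps power_add[symmetric])

text \<open>The limiting number of changes up to \<open>x\<close> is a monotone, locally bounded, integer valued function
  that increases strictly whenever the value of \<open>f\<close> changes between two dyadic points. It is
  therefore locally constant on both sides of every point, and hence so is \<open>f\<close>.\<close>

lemma locally_step_if_bounded_changes:
  fixes f :: "real \<Rightarrow> real"
  assumes rc: "\<And>t. 0 \<le> t \<Longrightarrow> continuous (at_right t) f"
    and bounded: "\<And>N::nat. \<exists>K. \<forall>m. card (changes f m N) \<le> K"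
  shows "locally_step f"
proof -
  let ?c = "\<lambda>m x. card (changes f m x)"
  define A where "A x = (SUP m. ?c m x)" for x
  have bdd: "bdd_above (range (\<lambda>m. ?c m x))" for x
  proof -
    obtain N :: nat where "x \<le> N" using real_arch_simple by blast
    moreover obtain K where "\<forall>m. ?c m N \<le> K" using bounded by blast
    ultimately have "?c m x \<le> K" for m using card_changes_mono order_trans by blast
    then show ?thesis by (intro bdd_aboveI2[of _ _ K])
  qed
  have le_A: "?c m x \<le> A x" for m x
    unfolding A_def by (rule cSUP_upper[OF _ bdd]) simp
  have A_mono: "A x \<le> A y" if "x \<le> y" for x y
    unfolding A_def using that by (intro cSUP_mono bdd) (auto intro: card_changes_mono)
  have A_attained: "\<exists>m. ?c m x = A x" for x
  proof -
    have "finite (range (\<lambda>m. ?c m x))" using bdd[of x] by (simp add: bdd_above_nat)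
    then have "A x \<in> range (\<lambda>m. ?c m x)"
      unfolding A_def using Max_in[of "range (\<lambda>m. ?c m x)"] by (subst cSup_eq_Max) auto
    then show ?thesis by auto
  qed
  have c_mono: "?c m x \<le> ?c n x" if "m \<le> n" for m n x
    using lift_Suc_mono_le[of "\<lambda>m. ?c m x", OF card_changes_Suc that] .
  have strict: "A (real i / 2 ^ m) < A (real j / 2 ^ n)"
    if less: "real i / 2 ^ m < real j / 2 ^ n" and neq: "f (real i / 2 ^ m) \<noteq> f (real j / 2 ^ n)"
    for i j m n
  proof -
    obtain r where r: "?c r (real i / 2 ^ m) = A (real i / 2 ^ m)" using A_attained by blast
    define M where "M = max r (max m n)"
    define i' j' where "i' = i * 2 ^ (M - m)" and "j' = j * 2 ^ (M - n)"
    have i': "real i / 2 ^ m = real i' / 2 ^ M" and j': "real j / 2 ^ n = real j' / 2 ^ M"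
      unfolding i'_def j'_def by (intro dyadic_refine; simp add: M_def)+
    have "i' < j'" using less unfolding i' j' by (simp add: divide_less_cancel)
    have "\<exists>k\<ge>i'. k < j' \<and> f (real (k + 1) / 2 ^ M) \<noteq> f (real k / 2 ^ M)"
    proof (rule ccontr)
      assume nex: "\<not> ?thesis"
      have "f (real k / 2 ^ M) = f (real i' / 2 ^ M)" if "i' \<le> k" "k \<le> j'" for k
        using that
      proof (induction k rule: dec_induct)
        case base then show ?case by simp
      next
        case (step k)
        then show ?case using nex by (metis Suc_eq_plus1 Suc_leD Suc_le_lessD)
      qed
      from this[of j'] neq \<open>i' < j'\<close> show False unfolding i' j' by simp
    qed
    then obtain k where k: "i' \<le> k" "k < j'" "f (real (k + 1) / 2 ^ M) \<noteq> f (real k / 2 ^ M)" by blast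
    have "insert k (changes f M (real i' / 2 ^ M)) \<subseteq> changes f M (real j' / 2 ^ M)"
    proof -
      have "real i' / 2 ^ M \<le> real j' / 2 ^ M" "real (k + 1) / 2 ^ M \<le> real j' / 2 ^ M"
        using k \<open>i' < j'\<close> by (simp_all add: divide_right_mono del: of_nat_add)
      then show ?thesis using k(3) unfolding changes_def by (auto simp del: of_nat_add)
    qed
    then have "card (insert k (changes f M (real i' / 2 ^ M))) \<le> ?c M (real j' / 2 ^ M)"
      by (intro card_mono finite_changes)
    moreover have "k \<notin> changes f M (real i' / 2 ^ M)"
      using k by (auto simp: changes_def divide_le_cancel)
    ultimately have "?c M (real i' / 2 ^ M) < ?c M (real j' / 2 ^ M)"
      by (simp add: finite_changes)
    moreover have "A (real i / 2 ^ m) \<le> ?c M (real i / 2 ^ m)"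
      using c_mono[of r M] r unfolding M_def by (metis max.cobounded1)
    ultimately show ?thesis using le_A[of M "real j / 2 ^ n"] unfolding i' j' by linarith
  qed
  \<comment> \<open>Where the count is constant, \<open>f\<close> is constant on dyadic points, hence everywhere by right-continuity.\<close>
  have const: "f y = f z" if yz: "0 \<le> y" "y < q" "0 \<le> z" "z < q"
    and p: "p \<le> y" "p \<le> z"
    and A_eq: "\<And>x. p < x \<Longrightarrow> x < q \<Longrightarrow> A x = n" for p q y z n
  proof -
    have D: "f (real i / 2 ^ m) = f (real j / 2 ^ k)"
      if "p < real i / 2 ^ m" "real i / 2 ^ m < q" "p < real j / 2 ^ k" "real j / 2 ^ k < q" for i m j k
      using strict[of i m j k] strict[of j k i m] A_eq that
      by (metis less_irrefl linorder_neqE_linordered_idom)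
    obtain k j where kj: "y < real k / 2 ^ j" "real k / 2 ^ j < q"
      using dyadic_between yz by metis
    have "f w = f (real k / 2 ^ j)" if w: "0 \<le> w" "w < q" "p \<le> w" for w
    proof (rule ccontr)
      assume neq: "f w \<noteq> f (real k / 2 ^ j)"
      have "(f \<longlongrightarrow> f w) (at_right w)"
        using rc[OF w(1)] by (simp add: continuous_within)
      then have "\<forall>\<^sub>F u in at_right w. f u \<noteq> f (real k / 2 ^ j)"
        using neq by (rule tendsto_imp_eventually_ne)
      then obtain e where e: "e > w" "\<And>u. w < u \<Longrightarrow> u < e \<Longrightarrow> f u \<noteq> f (real k / 2 ^ j)"
        unfolding eventually_at_right_field by blast
      obtain m i :: nat where "w < real i / 2 ^ m" "real i / 2 ^ m < min e q"
        using dyadic_between[of w "min e q"] w e by (metis min_less_iff_conj)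
      with e(2)[of "real i / 2 ^ m"] D[of i m k j] kj w p show False by auto
    qed
    with yz p show ?thesis by metis
  qed
  show ?thesis
    unfolding locally_step_def
  proof (intro allI impI)
    fix x :: real assume x: "0 \<le> x"
    \<comment> \<open>On \<open>(x, y0]\<close> the count is constant because it is minimal at \<open>y0\<close> among all points beyond \<open>x\<close>.\<close>
    obtain y0 where y0: "x < y0" "\<And>y. x < y \<Longrightarrow> A y0 \<le> A y"
      using ex_has_least_nat[of "\<lambda>y. x < y" "x + 1" A] by auto
    have right: "f y = f x" if "x \<le> y" "y < y0" for y
      by (rule const[where p=x and q=y0 and n="A y0"]) (use that x y0 A_mono in \<open>auto intro!: order_antisym\<close>)
    obtain y1 where y1: "y1 < x" "\<And>y. y < x \<Longrightarrow> A y \<le> A y1"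
    proof -
      obtain y1 where "y1 < x" "\<And>y. y < x \<Longrightarrow> A x - A y1 \<le> A x - A y"
        using ex_has_least_nat[of "\<lambda>y. y < x" "x - 1" "\<lambda>y. A x - A y"] by auto
      moreover have "A y \<le> A x" if "y < x" for y using A_mono that by simp
      ultimately show ?thesis using that by (metis diff_le_mono2 diff_diff_cancel)
    qed
    have left: "f y = f z" if "0 \<le> y" "y1 < y" "y < x" "0 \<le> z" "y1 < z" "z < x" for y z
      by (rule const[where p=y1 and q=x and n="A y1"]) (use that y1 A_mono in \<open>auto intro: order_antisym\<close>)
    define l where "l = f (max 0 ((y1 + x) / 2))"
    have left': "f y = l" if "0 \<le> y" "y1 < y" "y < x" for y
      unfolding l_def using left[of y "max 0 ((y1 + x) / 2)"] that y1(1) by (auto simp: max_def)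
    show "\<exists>d>0. \<exists>l. (\<forall>y. 0 \<le> y \<longrightarrow> x - d < y \<longrightarrow> y < x \<longrightarrow> f y = l) \<and> (\<forall>y. x \<le> y \<longrightarrow> y < x + d \<longrightarrow> f y = f x)"
    proof (rule exI[of _ "min (y0 - x) (x - y1)"], intro conjI exI[of _ l] allI impI)
      show "0 < min (y0 - x) (x - y1)" using y0(1) y1(1) by simp
    qed (auto intro: left' right)
  qed
qed

text \<open>Such a decomposition exists near every point, where \<open>g\<close> has at most one jump, and decompositions on
  adjacent intervals can be glued by shifting the second one. Compactness of \<open>[0, b]\<close> does the rest.\<close>

lemma locally_step_decomposition:
  fixes g :: "real \<Rightarrow> real"
  assumes g: "locally_step g" and "0 \<le> b"
  obtains F G where "mono F" "mono G" "\<And>x. continuous (at_right x) F" "\<And>x. continuous (at_right x) G"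
    "\<And>x. x \<in> {0..b} \<Longrightarrow> g x = F x - G x"
proof -
  define P where "P a b \<longleftrightarrow> (0 \<le> a \<longrightarrow> (\<exists>F G. mono F \<and> mono G \<and>
      (\<forall>x. continuous (at_right x) F) \<and> (\<forall>x. continuous (at_right x) G) \<and>
      (\<forall>x\<in>{a..b}. g x = F x - G x)))" for a b
  \<comment> \<open>The summand \<open>r\<close> allows for an upward jump of the glued function at \<open>b\<close>.\<close>
  have join: "mono H \<and> (\<forall>x. continuous (at_right x) H)"
    if H: "H = (\<lambda>x. if x < b then F1 x else F1 b + r + (F2 x - F2 b))" and "0 \<le> r"
      and m: "mono F1" "mono F2"
      and c: "\<forall>x. continuous (at_right x) F1" "\<forall>x. continuous (at_right x) F2"
    for F1 F2 H :: "real \<Rightarrow> real" and b r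
  proof (intro conjI allI)
    show "mono H"
    proof (rule monoI)
      fix x y :: real assume "x \<le> y"
      then show "H x \<le> H y"
        using monoD[OF m(1), of x y] monoD[OF m(2), of x y] monoD[OF m(1), of x b] monoD[OF m(2), of b y]
        using \<open>0 \<le> r\<close> by (auto simp: H)
    qed
    fix x
    show "continuous (at_right x) H"
    proof (cases "x < b")
      case True
      have "\<forall>\<^sub>F y in at_right x. F1 y = H y"
        using True unfolding eventually_at_right_field by (intro exI[of _ b]) (auto simp: H)
      moreover have "(F1 \<longlongrightarrow> H x) (at_right x)"
        using c(1) True by (simp add: continuous_within H)
      ultimately show ?thesis
        unfolding continuous_within by (rule Lim_transform_eventually[rotated])
    next
      case False
      have "\<forall>\<^sub>F y in at_right x. F1 b + r + (F2 y - F2 b) = H y"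
        using False unfolding eventually_at_right_field by (intro exI[of _ "x + 1"]) (auto simp: H)
      moreover have "((\<lambda>y. F1 b + r + (F2 y - F2 b)) \<longlongrightarrow> H x) (at_right x)"
        using c(2) False unfolding H by (auto simp: continuous_within intro!: tendsto_intros)
      ultimately show ?thesis
        unfolding continuous_within by (rule Lim_transform_eventually[rotated])
    qed
  qed
  have "P 0 b" using \<open>0 \<le> b\<close>
  proof (induction rule: Bolzano)
    case (trans a b c)
    show ?case unfolding P_def
    proof
      assume "0 \<le> a"
      then have ab: "0 \<le> a" "0 \<le> b" using trans by auto
      from trans(1)[unfolded P_def, rule_format, OF ab(1)] obtain F1 G1 where
        1: "mono F1" "mono G1" "\<forall>x. continuous (at_right x) F1" "\<forall>x. continuous (at_right x) G1"
          "\<forall>x\<in>{a..b}. g x = F1 x - G1 x" by blast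
      from trans(2)[unfolded P_def, rule_format, OF ab(2)] obtain F2 G2 where
        2: "mono F2" "mono G2" "\<forall>x. continuous (at_right x) F2" "\<forall>x. continuous (at_right x) G2"
          "\<forall>x\<in>{b..c}. g x = F2 x - G2 x"
        by blast
      let ?F = "\<lambda>x. if x < b then F1 x else F1 b + 0 + (F2 x - F2 b)"
      let ?G = "\<lambda>x. if x < b then G1 x else G1 b + 0 + (G2 x - G2 b)"
      have "g x = ?F x - ?G x" if "x \<in> {a..c}" for x
        using 1(5)[rule_format, of b] 2(5)[rule_format, of b] 1(5) 2(5) that trans by auto
      then show "\<exists>F G. mono F \<and> mono G \<and> (\<forall>x. continuous (at_right x) F) \<and>
          (\<forall>x. continuous (at_right x) G) \<and> (\<forall>x\<in>{a..c}. g x = F x - G x)"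
        using join[OF refl order_refl 1(1) 2(1) 1(3) 2(3), of b] join[OF refl order_refl 1(2) 2(2) 1(4) 2(4), of b]
        by (intro exI[of _ ?F] exI[of _ ?G]) simp
    qed
  next
    case (local x)
    then obtain d l where d: "d > 0" "\<And>y. 0 \<le> y \<Longrightarrow> x - d < y \<Longrightarrow> y < x \<Longrightarrow> g y = l"
      "\<And>y. x \<le> y \<Longrightarrow> y < x + d \<Longrightarrow> g y = g x"
      using g unfolding locally_step_def by blast
    \<comment> \<open>The jump of \<open>g\<close> at \<open>x\<close> goes into \<open>F\<close> if it is upward and into \<open>G\<close> if it is downward.\<close>
    let ?F = "\<lambda>y. if y < x then l else l + max 0 (g x - l)"
    let ?G = "\<lambda>y. if y < x then 0 else max 0 (l - g x)"
    have "P a b" if "a \<le> x \<and> x \<le> b \<and> b - a < d" for a b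
      unfolding P_def
    proof (rule impI, rule exI[of _ ?F], rule exI[of _ ?G], intro conjI)
      have "mono ?F \<and> (\<forall>y. continuous (at_right y) ?F)"
        by (rule join[of ?F x "\<lambda>_. l" "max 0 (g x - l)" "\<lambda>_. l"]) (auto simp: mono_def)
      then show "mono ?F" "\<forall>y. continuous (at_right y) ?F" by blast+
      have "mono ?G \<and> (\<forall>y. continuous (at_right y) ?G)"
        by (rule join[of ?G x "\<lambda>_. 0" "max 0 (l - g x)" "\<lambda>_. 0"]) (auto simp: mono_def)
      then show "mono ?G" "\<forall>y. continuous (at_right y) ?G" by blast+
      show "\<forall>y\<in>{a..b}. g y = ?F y - ?G y"
        if "0 \<le> a"
      proof
        fix y assume "y \<in> {a..b}"
        then have "y < x \<Longrightarrow> g y = l" "x \<le> y \<Longrightarrow> g y = g x"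
          using that \<open>a \<le> x \<and> x \<le> b \<and> b - a < d\<close> by (auto intro: d(2,3))
        then show "g y = ?F y - ?G y" by (cases "y < x") auto
      qed
    qed
    then show ?case using d(1) by blast
  qed
  then show ?thesis using that unfolding P_def by blast
qed

lemma left_limit_eq:
  assumes "z < y" "\<And>u. z < u \<Longrightarrow> u < y \<Longrightarrow> f u = l"
  shows "left_limit f y = l"
proof -
  have "\<forall>\<^sub>F u in at_left y. l = f u"
    using assms unfolding eventually_at_left_field by (intro exI[of _ z]) auto
  then have "(f \<longlongrightarrow> l) (at_left y)"
    by (rule Lim_transform_eventually[OF tendsto_const])
  then show ?thesis unfolding left_limit_def by (intro tendsto_Lim) auto
qed

text \<open>These are the properties that make \<open>exp (-\<xi>)\<close> at left limits integrable against any Stieltjes measure.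
  Locally the left limit takes two values, one up to and including the point and one beyond it.\<close>

lemma locally_step_left_limit:
  fixes f h :: "real \<Rightarrow> real"
  assumes f: "locally_step f" and "0 \<le> b"
  shows "(\<lambda>y. indicator {0<..b} y * h (left_limit f y)) \<in> borel_measurable borel"
    and "\<exists>B. \<forall>y\<in>{0<..b}. \<bar>h (left_limit f y)\<bar> \<le> B"
proof -
  define P where "P a b \<longleftrightarrow> (0 \<le> a \<longrightarrow>
      (\<lambda>y. indicator {a<..b} y * h (left_limit f y)) \<in> borel_measurable borel \<and>
      (\<exists>B. \<forall>y\<in>{a<..b}. \<bar>h (left_limit f y)\<bar> \<le> B))" for a b
  have "P 0 b" using \<open>0 \<le> b\<close>
  proof (induction rule: Bolzano)
    case (trans a b c)
    show ?case unfolding P_def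
    proof (intro impI conjI)
      assume a: "0 \<le> a"
      let ?k = "\<lambda>a b y. indicator {a<..b} y * h (left_limit f y)"
      have "?k a b \<in> borel_measurable borel" "?k b c \<in> borel_measurable borel"
        using trans a unfolding P_def by auto
      then have "(\<lambda>y. ?k a b y + ?k b c y) \<in> borel_measurable borel" by (rule borel_measurable_add)
      also have "(\<lambda>y. ?k a b y + ?k b c y) = ?k a c"
        using trans by (auto simp: fun_eq_iff indicator_def)
      finally show "?k a c \<in> borel_measurable borel" .
      obtain B1 B2 where "\<forall>y\<in>{a<..b}. \<bar>h (left_limit f y)\<bar> \<le> B1" "\<forall>y\<in>{b<..c}. \<bar>h (left_limit f y)\<bar> \<le> B2"
        using trans a unfolding P_def by (meson order_trans)
      then show "\<exists>B. \<forall>y\<in>{a<..c}. \<bar>h (left_limit f y)\<bar> \<le> B"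
        by (intro exI[of _ "max B1 B2"]) (metis greaterThanAtMost_iff le_max_iff_disj linorder_not_le)
    qed
  next
    case (local x)
    then obtain d l where d: "d > 0" "\<And>y. 0 \<le> y \<Longrightarrow> x - d < y \<Longrightarrow> y < x \<Longrightarrow> f y = l"
      "\<And>y. x \<le> y \<Longrightarrow> y < x + d \<Longrightarrow> f y = f x"
      using f unfolding locally_step_def by blast
    have "P a b" if ab: "a \<le> x \<and> x \<le> b \<and> b - a < d" for a b
      unfolding P_def
    proof (intro impI conjI)
      assume a: "0 \<le> a"
      have 1: "left_limit f y = l" if "y \<in> {a<..x}" for y
      proof (rule left_limit_eq[of a])
        show "a < y" using that by simp
        fix u assume "a < u" "u < y"
        then show "f u = l" using that ab a by (intro d(2)) auto
      qed
      have 2: "left_limit f y = f x" if "y \<in> {x<..b}" for y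
      proof (rule left_limit_eq[of x])
        show "x < y" using that by simp
        fix u assume "x < u" "u < y"
        then show "f u = f x" using that ab a by (intro d(3)) auto
      qed
      have "(\<lambda>y. indicator {a<..b} y * h (left_limit f y))
          = (\<lambda>y. indicator {a<..x} y * h l + indicator {x<..b} y * h (f x))"
        using 1 2 ab by (auto simp: fun_eq_iff indicator_def)
      then show "(\<lambda>y. indicator {a<..b} y * h (left_limit f y)) \<in> borel_measurable borel" by simp
      show "\<exists>B. \<forall>y\<in>{a<..b}. \<bar>h (left_limit f y)\<bar> \<le> B"
      proof (intro exI[of _ "max \<bar>h l\<bar> \<bar>h (f x)\<bar>"] ballI)
        fix y assume "y \<in> {a<..b}"
        then show "\<bar>h (left_limit f y)\<bar> \<le> max \<bar>h l\<bar> \<bar>h (f x)\<bar>"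
          using 1[of y] 2[of y] by (cases "y \<le> x") auto
      qed
    qed
    then show ?case using d(1) by blast
  qed
  then show "(\<lambda>y. indicator {0<..b} y * h (left_limit f y)) \<in> borel_measurable borel"
    and "\<exists>B. \<forall>y\<in>{0<..b}. \<bar>h (left_limit f y)\<bar> \<le> B"
    unfolding P_def by auto
qed

section \<open>Pathwise Stieltjes integrals\<close>

text \<open>\<open>F\<close> and \<open>G\<close> have the same increments over subintervals of \<open>(a, b]\<close>, so their Stieltjes measures coincide
  when restricted to \<open>(a, b]\<close>.\<close>

lemma interval_measure_cong_Ioc:
  assumes "mono F" "mono G" "\<And>x. continuous (at_right x) F" "\<And>x. continuous (at_right x) G"
    and "a \<le> b" and diff: "\<And>x. x \<in> {a..b} \<Longrightarrow> F x - G x = c"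
    and f[measurable]: "(\<lambda>x. indicator {a<..b} x * f x) \<in> borel_measurable borel"
  shows "(LINT x:{a<..b}|interval_measure F. f x) = (LINT x:{a<..b}|interval_measure G. (f x :: real))"
proof -
  have em: "emeasure (interval_measure H) {u<..v} = ennreal (H v - H u)"
    if "mono H" "\<And>x. continuous (at_right x) H" "u \<le> v" for H :: "real \<Rightarrow> real" and u v
    using that by (intro emeasure_interval_measure_Ioc) (auto simp: mono_def)
  have Int: "{x<..} \<inter> {a<..b} = (if max x a \<le> b then {max x a<..b} else {})" for x
    by auto
  let ?d = "\<lambda>H. density (interval_measure H) (\<lambda>x. ennreal (indicator {a<..b} x))"
  have dens: "emeasure (?d H) {x<..} = ennreal (if max x a \<le> b then H b - H (max x a) else 0)"
    if "mono H" "\<And>x. continuous (at_right x) H" for H :: "real \<Rightarrow> real" and x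
  proof -
    have "emeasure (?d H) {x<..} = emeasure (interval_measure H) ({x<..} \<inter> {a<..b})"
      by (subst emeasure_density) (auto simp: ennreal_indicator indicator_inter_arith[symmetric] Int_commute)
    also have "\<dots> = ennreal (if max x a \<le> b then H b - H (max x a) else 0)"
      unfolding Int using em[OF that, of "max x a" b] by auto
    finally show ?thesis .
  qed
  have "?d F = ?d G"
  proof (rule measure_eqI_lessThan)
    show "emeasure (?d F) {x<..} < \<infinity>" for x
      by (simp only: dens[OF assms(1,3)]) simp
    show "emeasure (?d F) {x<..} = emeasure (?d G) {x<..}" for x
    proof (cases "max x a \<le> b")
      case True
      then have "F b - F (max x a) = G b - G (max x a)"
        using diff[of b] diff[of "max x a"] \<open>a \<le> b\<close> by auto
      then show ?thesis by (simp only: dens[OF assms(1,3)] dens[OF assms(2,4)] if_True True)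
    next
      case False
      then show ?thesis by (simp only: dens[OF assms(1,3)] dens[OF assms(2,4)] if_False)
    qed
  qed auto
  moreover have "(LINT x:{a<..b}|interval_measure H. f x) = (LINT x|?d H. indicator {a<..b} x * f x)" for H
    by (subst integral_density)
       (auto simp: set_lebesgue_integral_def mult.assoc[symmetric] indicator_inter_arith[symmetric])
  ultimately show ?thesis by simp
qed

text \<open>The two halves of any decomposition of \<open>g\<close> cancel where \<open>g\<close> is constant, no matter how irregular
  \<open>f\<close> is. Together with the next two lemmas this determines the integral, independently of the
  decomposition, whenever on each piece of a partition one of \<open>f\<close> and \<open>g\<close> is constant.\<close>

lemma has_stieltjes_integral_const_integrator:
  assumes "has_stieltjes_integral f g a b I" "a \<le> b" "\<And>x. x \<in> {a..b} \<Longrightarrow> g x = c"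
  shows "I = 0"
proof -
  obtain F G where FG: "mono F" "mono G"
        "\<forall>x. continuous (at_right x) F" "\<forall>x. continuous (at_right x) G"
        "\<forall>x\<in>{a..b}. g x = F x - G x"
        "set_integrable (interval_measure F) {a<..b} f"
        "I = (LINT x:{a<..b}|interval_measure F. f x) - (LINT x:{a<..b}|interval_measure G. f x)"
    using assms(1) unfolding has_stieltjes_integral_def by blast
  have "(\<lambda>x. indicator {a<..b} x * f x) \<in> borel_measurable borel"
    using borel_measurable_integrable[OF FG(6)[unfolded set_integrable_def]] by simp
  with FG have "(LINT x:{a<..b}|interval_measure F. f x) = (LINT x:{a<..b}|interval_measure G. f x)"
    using assms by (intro interval_measure_cong_Ioc[where c=c]) auto
  then show ?thesis using FG by simp
qed

lemma has_stieltjes_integral_const_integrand: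
  assumes "has_stieltjes_integral f g a b I" "a \<le> b" "\<And>x. x \<in> {a<..b} \<Longrightarrow> f x = c"
  shows "I = c * (g b - g a)"
proof -
  obtain F G where FG: "mono F" "mono G"
        "\<forall>x. continuous (at_right x) F" "\<forall>x. continuous (at_right x) G"
        "\<forall>x\<in>{a..b}. g x = F x - G x"
        "I = (LINT x:{a<..b}|interval_measure F. f x) - (LINT x:{a<..b}|interval_measure G. f x)"
    using assms(1) unfolding has_stieltjes_integral_def by blast
  have H: "(LINT x:{a<..b}|interval_measure H. f x) = c * (H b - H a)"
    if "mono H" "\<forall>x. continuous (at_right x) H" for H
  proof -
    have "(LINT x:{a<..b}|interval_measure H. f x) = (LINT x:{a<..b}|interval_measure H. c)"
      by (intro set_lebesgue_integral_cong) (use assms in auto)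
    also have "\<dots> = c * measure (interval_measure H) {a<..b}"
      by (simp add: set_lebesgue_integral_def)
    also have "measure (interval_measure H) {a<..b} = H b - H a"
      using that \<open>a \<le> b\<close> by (intro measure_interval_measure_Ioc) (auto simp: mono_def)
    finally show ?thesis .
  qed
  have "g a = F a - G a" "g b = F b - G b" using FG(5) \<open>a \<le> b\<close> by auto
  then show ?thesis
    unfolding FG(6) H[OF FG(1,3)] H[OF FG(2,4)] by (simp only: right_diff_distrib)
qed

lemma has_stieltjes_integral_split:
  assumes "has_stieltjes_integral f g a c I" "a \<le> b" "b \<le> c"
  obtains J K where "has_stieltjes_integral f g a b J" "has_stieltjes_integral f g b c K" "I = J + K"
proof -
  obtain F G where FG: "mono F" "mono G"
        "\<forall>x. continuous (at_right x) F" "\<forall>x. continuous (at_right x) G"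
        "\<forall>x\<in>{a..c}. g x = F x - G x"
        "set_integrable (interval_measure F) {a<..c} f"
        "set_integrable (interval_measure G) {a<..c} f"
        "I = (LINT x:{a<..c}|interval_measure F. f x) - (LINT x:{a<..c}|interval_measure G. f x)"
    using assms(1) unfolding has_stieltjes_integral_def by blast
  have sub: "set_integrable (interval_measure H) {a<..b} f" "set_integrable (interval_measure H) {b<..c} f"
    and split: "(LINT x:{a<..c}|interval_measure H. f x)
      = (LINT x:{a<..b}|interval_measure H. f x) + (LINT x:{b<..c}|interval_measure H. f x)"
    if "set_integrable (interval_measure H) {a<..c} f" for H
  proof -
    show *: "set_integrable (interval_measure H) {a<..b} f" "set_integrable (interval_measure H) {b<..c} f"
      using that assms by (auto elim!: set_integrable_subset)
    have "{a<..c} = {a<..b} \<union> {b<..c}" "{a<..b} \<inter> {b<..c} = {}" using assms by auto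
    then show "(LINT x:{a<..c}|interval_measure H. f x)
      = (LINT x:{a<..b}|interval_measure H. f x) + (LINT x:{b<..c}|interval_measure H. f x)"
      using set_integral_Un[OF _ *] by simp
  qed
  let ?J = "\<lambda>a b. (LINT x:{a<..b}|interval_measure F. f x) - (LINT x:{a<..b}|interval_measure G. f x)"
  have "has_stieltjes_integral f g a b (?J a b)" "has_stieltjes_integral f g b c (?J b c)"
    unfolding has_stieltjes_integral_def
    using FG sub assms by (intro exI[of _ F] exI[of _ G]; auto)+
  moreover have "I = ?J a b + ?J b c"
    using FG split by simp
  ultimately show ?thesis using that by blast
qed

lemma has_stieltjes_integral_exists:
  fixes x g h :: "real \<Rightarrow> real"
  assumes "locally_step x" "locally_step g" "0 \<le> b"
  shows "\<exists>I. has_stieltjes_integral (\<lambda>s. h (left_limit x s)) g 0 b I"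
proof -
  let ?f = "\<lambda>s. h (left_limit x s)"
  obtain F G where FG: "mono F" "mono G" "\<And>x. continuous (at_right x) F" "\<And>x. continuous (at_right x) G"
    "\<And>x. x \<in> {0..b} \<Longrightarrow> g x = F x - G x"
    using locally_step_decomposition[OF assms(2,3)] by metis
  obtain B where B: "\<forall>y\<in>{0<..b}. \<bar>?f y\<bar> \<le> B"
    using locally_step_left_limit(2)[OF assms(1,3)] by blast
  note meas[measurable] = locally_step_left_limit(1)[OF assms(1,3), of h]
  have "set_integrable (interval_measure H) {0<..b} ?f"
    if "mono H" "\<And>x. continuous (at_right x) H" for H
    unfolding set_integrable_def real_scaleR_def
  proof (rule integrableI_bounded_set[where A="{0<..b}" and B=B])
    show "emeasure (interval_measure H) {0<..b} < \<infinity>"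
      using that \<open>0 \<le> b\<close> by (subst emeasure_interval_measure_Ioc) (auto simp: mono_def)
    show "AE y in interval_measure H. y \<in> {0<..b} \<longrightarrow> norm (indicat_real {0<..b} y * ?f y) \<le> B"
      using B by (intro AE_I2) auto
  qed (use meas in auto)
  then show ?thesis
    unfolding has_stieltjes_integral_def using FG by blast
qed

section \<open>Prescribed paths\<close>

text \<open>A prescription for successive unit intervals of time: \<open>None\<close> asks for rest, \<open>Some A\<close> for an increment
  in \<open>A\<close>. Rest is only tested at dyadic points, so that the prescription concerns countably many
  times and defines an event in the product \<open>\<sigma>\<close>-algebra on paths.\<close>

fun follows :: "(real \<Rightarrow> real) \<Rightarrow> real \<Rightarrow> real set option list \<Rightarrow> bool" where
  "follows f s [] \<longleftrightarrow> True"
| "follows f s (None # l) \<longleftrightarrow> (\<forall>m. \<forall>i\<le>2 ^ m. f (s + real i / 2 ^ m) = f s) \<and> follows f (s + 1) l"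
| "follows f s (Some A # l) \<longleftrightarrow> f (s + 1) - f s \<in> A \<and> follows f (s + 1) l"

lemma constant_if_dyadic_constant:
  fixes f :: "real \<Rightarrow> real"
  assumes rc: "\<And>t. 0 \<le> t \<Longrightarrow> continuous (at_right t) f" and "0 \<le> s"
    and dy: "\<And>m i. i \<le> 2 ^ m \<Longrightarrow> f (s + real i / 2 ^ m) = f s" and u: "u \<in> {s..s + 1}"
  shows "f u = f s"
proof (cases "u = s + 1")
  case True
  then show ?thesis using dy[of 1 0] by simp
next
  case False
  show ?thesis
  proof (rule ccontr)
    assume neq: "f u \<noteq> f s"
    have "(f \<longlongrightarrow> f u) (at_right u)"
      using rc[of u] u \<open>0 \<le> s\<close> by (simp add: continuous_within)
    then have "\<forall>\<^sub>F v in at_right u. f v \<noteq> f s"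
      using neq by (rule tendsto_imp_eventually_ne)
    then obtain e where e: "e > u" "\<And>v. u < v \<Longrightarrow> v < e \<Longrightarrow> f v \<noteq> f s"
      unfolding eventually_at_right_field by blast
    obtain m i :: nat where mi: "u - s < real i / 2 ^ m" "real i / 2 ^ m < min (e - s) 1"
      using dyadic_between[of "u - s" "min (e - s) 1"] u e(1) False
      by (metis add.commute add_diff_cancel_right' atLeastAtMost_iff diff_ge_0_iff_ge diff_strict_right_mono
          min_less_iff_conj order_less_le)
    have "real i < 2 ^ m" using mi by (simp add: field_simps)
    then have "i \<le> 2 ^ m" by (metis less_imp_le of_nat_less_iff of_nat_numeral of_nat_power)
    then show False using dy[of i m] e(2)[of "s + real i / 2 ^ m"] mi by auto
  qed
qed

text \<open>The exponential functional
  \<open>b\<^sub>0 + exp (- a\<^sub>0) (b\<^sub>1 + exp (- a\<^sub>1) (b\<^sub>2 + \<dots>))\<close> of paths on which \<open>\<eta>\<close> and \<open>\<xi>\<close>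
  move in turns, \<open>\<eta>\<close> by \<open>b\<^sub>j\<close> and then \<open>\<xi>\<close> by \<open>a\<^sub>j\<close>.\<close>

fun discounted_sum :: "(real \<times> real) list \<Rightarrow> real" where
  "discounted_sum [] = 0"
| "discounted_sum ((b, a) # l) = b + exp (- a) * discounted_sum l"

abbreviation close :: "real \<Rightarrow> real \<times> real \<Rightarrow> real \<times> real \<Rightarrow> bool" where
  "close d p p' \<equiv> \<bar>fst p' - fst p\<bar> < d \<and> \<bar>snd p' - snd p\<bar> < d"

lemma discounted_sum_continuous:
  assumes "e > 0"
  shows "\<exists>d>0. \<forall>l'. list_all2 (close d) l l' \<longrightarrow> \<bar>discounted_sum l' - discounted_sum l\<bar> < e"
  using assms
proof (induction l arbitrary: e)
  case Nil
  then show ?case by (auto intro: exI[of _ 1])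
next
  case (Cons p l)
  obtain b a where p: "p = (b, a)" by force
  let ?v = "discounted_sum l"
  let ?g = "\<lambda>z :: real \<times> real \<times> real. fst z + exp (- fst (snd z)) * snd (snd z)"
  have "isCont ?g (b, a, ?v)" by (intro continuous_intros)
  then obtain r where r: "r > 0" "\<And>z. dist z (b, a, ?v) < r \<Longrightarrow> dist (?g z) (?g (b, a, ?v)) < e"
    using Cons.prems unfolding continuous_at_eps_delta by metis
  obtain d where d: "d > 0" "\<And>l'. list_all2 (close d) l l' \<Longrightarrow> \<bar>discounted_sum l' - ?v\<bar> < r / 3"
    using Cons.IH[of "r / 3"] r by auto
  show ?case
  proof (intro exI[of _ "min d (r / 3)"] conjI allI impI)
    show "0 < min d (r / 3)" using d r by simp
    fix l'' assume "list_all2 (close (min d (r / 3))) (p # l) l''"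
    then obtain b' a' l' where l'': "l'' = (b', a') # l'" "\<bar>b' - b\<bar> < r / 3" "\<bar>a' - a\<bar> < r / 3"
      and "list_all2 (close (min d (r / 3))) l l'"
      by (auto simp: list_all2_Cons1 p)
    then have "list_all2 (close d) l l'" by (auto elim!: list_all2_mono)
    from d(2)[OF this] have v: "\<bar>discounted_sum l' - ?v\<bar> < r / 3" .
    have "dist (b', a', discounted_sum l') (b, a, ?v)
        \<le> \<bar>b' - b\<bar> + (\<bar>a' - a\<bar> + \<bar>discounted_sum l' - ?v\<bar>)"
      unfolding dist_Pair_Pair dist_real_def
      by (rule order_trans[OF sqrt_sum_squares_le_sum_abs])
         (simp add: order_trans[OF sqrt_sum_squares_le_sum_abs])
    also have "\<dots> < r" using l'' v by simp
    finally show "\<bar>discounted_sum l'' - discounted_sum (p # l)\<bar> < e"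
      using r(2)[of "(b', a', discounted_sum l')"] by (simp add: l'' p dist_real_def)
  qed
qed

text \<open>The two processes move in alternate unit intervals, \<open>\<eta>\<close> first. In the last interval \<open>\<eta>\<close> rests, which
  leaves room for the random time at which the integral ends.\<close>

definition eta_path :: "real \<Rightarrow> (real \<times> real) list \<Rightarrow> real set option list" where
  "eta_path d l = concat (map (\<lambda>(b, a). [Some {b - d<..<b + d}, None]) l) @ [None]"

definition xi_path :: "real \<Rightarrow> (real \<times> real) list \<Rightarrow> real set option list" where
  "xi_path d l = concat (map (\<lambda>(b, a). [None, Some {a - d<..<a + d}]) l) @ [None]"

text \<open>While \<open>\<xi>\<close> rests the integrand is constant, so only the total increment of \<open>\<eta>\<close> counts; while \<open>\<eta>\<close> rests
  the integral does not change. Only the increments over unit intervals therefore enter.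
  The list \<open>l'\<close> must not depend on \<open>I\<close>, since this is what yields uniqueness of the
  integral.\<close>

lemma has_stieltjes_integral_along_paths:
  fixes x y :: "real \<Rightarrow> real"
  assumes rcx: "\<And>t. 0 \<le> t \<Longrightarrow> continuous (at_right t) x"
    and rcy: "\<And>t. 0 \<le> t \<Longrightarrow> continuous (at_right t) y"
    and "0 \<le> s" "follows x s (xi_path d l)" "follows y s (eta_path d l)"
    and "s + 2 * length l \<le> t" "t \<le> s + 2 * length l + 1"
  shows "\<exists>l'. list_all2 (close d) l l' \<and>
    (\<forall>I. has_stieltjes_integral (\<lambda>s. exp (- left_limit x s)) y s t I
      \<longrightarrow> I = exp (- x s) * discounted_sum l')"
  using assms(3-)
proof (induction l arbitrary: s)
  case Nil
  have dy: "y (s + real i / 2 ^ m) = y s" if "i \<le> 2 ^ m" for m i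
    using Nil(3) that by (simp add: eta_path_def)
  have y: "y u = y s" if "u \<in> {s..t}" for u
    by (rule constant_if_dyadic_constant[OF rcy Nil(1) dy]) (use Nil(5) that in auto)
  have "I = 0" if "has_stieltjes_integral (\<lambda>s. exp (- left_limit x s)) y s t I" for I
    by (rule has_stieltjes_integral_const_integrator[OF that _ y]) (use Nil(4) in auto)
  then show ?case by simp
next
  case (Cons p l)
  obtain b a where p: "p = (b, a)" by force
  have dx: "x (s + real i / 2 ^ m) = x s" if "i \<le> 2 ^ m" for m i
    using Cons.prems(2) that by (simp add: xi_path_def p)
  have dy: "y (s + 1 + real i / 2 ^ m) = y (s + 1)" if "i \<le> 2 ^ m" for m i
    using Cons.prems(3) that by (simp add: eta_path_def p)
  have x1: "x u = x s" if "u \<in> {s..s + 1}" for u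
    by (rule constant_if_dyadic_constant[OF rcx Cons.prems(1) dx that])
  have y1: "y u = y (s + 1)" if "u \<in> {s + 1..s + 1 + 1}" for u
    by (rule constant_if_dyadic_constant[OF rcy add_nonneg_nonneg[OF Cons.prems(1) zero_le_one] dy that])
  let ?f = "\<lambda>s. exp (- left_limit x s)"
  have t: "s + 1 \<le> t" "s + 1 + 1 \<le> t" using Cons.prems by auto
  have f1: "?f u = exp (- x s)" if "u \<in> {s<..s + 1}" for u
  proof -
    have "left_limit x u = x s"
      by (rule left_limit_eq[of s u x]) (use that in \<open>auto intro: x1\<close>)
    then show ?thesis by simp
  qed
  have "\<exists>l'. list_all2 (close d) l l' \<and> (\<forall>I. has_stieltjes_integral ?f y (s + 1 + 1) t I
      \<longrightarrow> I = exp (- x (s + 1 + 1)) * discounted_sum l')"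
  proof (rule Cons.IH)
    show "0 \<le> s + 1 + 1" using Cons.prems(1) by simp
    show "follows x (s + 1 + 1) (xi_path d l)" using Cons.prems(2) by (simp add: xi_path_def p)
    show "follows y (s + 1 + 1) (eta_path d l)" using Cons.prems(3) by (simp add: eta_path_def p)
    show "s + 1 + 1 + 2 * length l \<le> t" "t \<le> s + 1 + 1 + 2 * length l + 1"
      using Cons.prems(4,5) by simp_all
  qed
  then obtain l' where l': "list_all2 (close d) l l'"
    "\<And>I. has_stieltjes_integral ?f y (s + 1 + 1) t I
      \<Longrightarrow> I = exp (- x (s + 1 + 1)) * discounted_sum l'"
    by blast
  let ?b = "y (s + 1) - y s" and ?a = "x (s + 1 + 1) - x (s + 1)"
  have "I = exp (- x s) * discounted_sum ((?b, ?a) # l')" if I: "has_stieltjes_integral ?f y s t I" for I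
  proof -
    obtain I1 I' where I1: "has_stieltjes_integral ?f y s (s + 1) I1"
      and I': "has_stieltjes_integral ?f y (s + 1) t I'" "I = I1 + I'"
      using has_stieltjes_integral_split[OF I, of "s + 1"] t by auto
    obtain I2 I3 where I2: "has_stieltjes_integral ?f y (s + 1) (s + 1 + 1) I2"
      and I3: "has_stieltjes_integral ?f y (s + 1 + 1) t I3" "I' = I2 + I3"
      using has_stieltjes_integral_split[OF I'(1), of "s + 1 + 1"] t by auto
    have 1: "I1 = exp (- x s) * ?b"
      using has_stieltjes_integral_const_integrand[OF I1 _ f1] by simp
    have 2: "I2 = 0"
      using has_stieltjes_integral_const_integrator[OF I2 _ y1] by simp
    have "- x (s + 1 + 1) = - x s + - ?a" using x1[of "s + 1"] by simp
    then have "exp (- x (s + 1 + 1)) = exp (- x s) * exp (- ?a)" by (simp only: exp_add)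
    then show ?thesis
      using 1 2 I'(2) I3(2) l'(2)[OF I3(1)] by (simp add: distrib_left)
  qed
  moreover have "list_all2 (close d) (p # l) ((?b, ?a) # l')"
    using Cons.prems p l'(1) by (auto simp: xi_path_def eta_path_def)
  ultimately show ?case by blast
qed

lemma stieltjes_integral_along_paths:
  fixes x y :: "real \<Rightarrow> real" and t :: real
  assumes rc: "\<And>t. 0 \<le> t \<Longrightarrow> continuous (at_right t) x" "\<And>t. 0 \<le> t \<Longrightarrow> continuous (at_right t) y"
    and ls: "locally_step x" "locally_step y" and "x 0 = 0"
    and path: "follows x 0 (xi_path d l)" "follows y 0 (eta_path d l)"
    and t: "2 * length l \<le> t" "t \<le> 2 * length l + 1"
  shows "\<exists>l'. list_all2 (close d) l l' \<and>
    stieltjes_integral (\<lambda>s. exp (- left_limit x s)) y 0 t = discounted_sum l'"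
proof -
  obtain l' where l': "list_all2 (close d) l l'"
    "\<And>I. has_stieltjes_integral (\<lambda>s. exp (- left_limit x s)) y 0 t I \<Longrightarrow> I = discounted_sum l'"
    using has_stieltjes_integral_along_paths[OF rc order_refl path, of t] t \<open>x 0 = 0\<close> by auto
  obtain I where "has_stieltjes_integral (\<lambda>s. exp (- left_limit x s)) y 0 t I"
    using has_stieltjes_integral_exists[OF ls, of t "\<lambda>u. exp (- u)"] t by auto
  then have "stieltjes_integral (\<lambda>s. exp (- left_limit x s)) y 0 t = discounted_sum l'"
    unfolding stieltjes_integral_def using l'(2) by (metis (no_types, lifting) the_equality)
  with l'(1) show ?thesis by blast
qed

section \<open>Prescribed increments of a Levy process\<close>

fun incs :: "(real \<Rightarrow> real) \<Rightarrow> real \<Rightarrow> (real \<times> real set) list \<Rightarrow> bool" where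
  "incs f s [] \<longleftrightarrow> True"
| "incs f s ((h, A) # l) \<longleftrightarrow> f (s + h) - f s \<in> A \<and> incs f (s + h) l"

lemma incs_append: "incs f s (k @ l) \<longleftrightarrow> incs f s k \<and> incs f (s + sum_list (map fst k)) l"
  by (induction f s k rule: incs.induct) (auto simp: add.assoc)

lemma incs_replicate_0:
  "incs f s (replicate n (h, {0})) \<longleftrightarrow> (\<forall>i\<le>n. f (s + real i * h) = f s)"
proof (induction n arbitrary: s)
  case 0
  then show ?case by simp
next
  case (Suc n)
  have eq: "s + h + real i * h = s + real (Suc i) * h" for i
    by (simp add: algebra_simps)
  have "incs f s (replicate (Suc n) (h, {0})) \<longleftrightarrow>
      f (s + h) = f s \<and> (\<forall>i\<le>n. f (s + real (Suc i) * h) = f (s + h))"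
    by (simp add: Suc eq del: of_nat_Suc)
  also have "\<dots> \<longleftrightarrow> (\<forall>i\<le>n. f (s + real (Suc i) * h) = f s)"
  proof -
    have "f (s + real (Suc 0) * h) = f (s + h)" by simp
    then show ?thesis by (metis le0)
  qed
  also have "\<dots> \<longleftrightarrow> (\<forall>i\<le>Suc n. f (s + real i * h) = f s)"
    by (metis Suc_le_mono add.right_neutral mult_zero_left not0_implies_Suc of_nat_0)
  finally show ?case .
qed

lemma incs_iff_nth:
  "incs f s l \<longleftrightarrow> (\<forall>i<length l. f (s + sum_list (map fst (take (Suc i) l))) -
      f (s + sum_list (map fst (take i l))) \<in> snd (l ! i))"
proof (induction f s l rule: incs.induct)
  case (2 f s h A l)
  then show ?case
    by (auto simp: less_Suc_eq_0_disj add.assoc)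
qed simp

lemma prob_incs:
  assumes levy: "levy_process M X" and "0 \<le> s"
    and l: "\<And>h A. (h, A) \<in> set l \<Longrightarrow> 0 \<le> h \<and> A \<in> sets borel"
  shows "measure M {\<omega> \<in> space M. incs (\<lambda>t. X t \<omega>) s l}
    = (\<Prod>(h, A)\<leftarrow>l. measure (distr M borel (X h)) A)"
proof -
  interpret prob_space M using levy by (simp add: levy_process_def)
  define t where "t i = s + sum_list (map fst (take i l))" for i
  have step: "t (Suc i) = t i + fst (l ! i)" if "i < length l" for i
    using that by (simp add: t_def take_Suc_conv_app_nth)
  have h: "0 \<le> fst (l ! i)" "snd (l ! i) \<in> sets borel" if "i < length l" for i
    using l[of "fst (l ! i)" "snd (l ! i)"] that by auto
  have t_nonneg: "0 \<le> t i" for i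
    unfolding t_def using \<open>0 \<le> s\<close> l
    by (intro add_nonneg_nonneg sum_list_nonneg) (auto dest!: in_set_takeD)
  have X: "X u \<in> borel_measurable M" if "0 \<le> u" for u
    using levy that by (simp add: levy_process_def)
  show ?thesis
  proof (cases "l = []")
    case True
    then show ?thesis by (simp add: prob_space)
  next
    case False
    have ind: "indep_vars (\<lambda>_. borel) (\<lambda>i \<omega>. X (t (Suc i)) \<omega> - X (t i) \<omega>) {..<length l}"
    proof -
      have "\<forall>i<length l. t i \<le> t (Suc i)" using step h by simp
      with levy t_nonneg[of 0] show ?thesis unfolding levy_process_def by blast
    qed
    have "{\<omega> \<in> space M. incs (\<lambda>t. X t \<omega>) s l}
        = (\<Inter>i<length l. (\<lambda>\<omega>. X (t (Suc i)) \<omega> - X (t i) \<omega>) -` snd (l ! i) \<inter> space M)"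
      using False by (auto simp: incs_iff_nth t_def)
    also have "prob \<dots> = (\<Prod>i<length l. prob ((\<lambda>\<omega>. X (t (Suc i)) \<omega> - X (t i) \<omega>) -` snd (l ! i) \<inter> space M))"
      using False h by (intro indep_varsD_finite[OF ind]) auto
    also have "\<dots> = (\<Prod>i<length l. measure (distr M borel (X (fst (l ! i)))) (snd (l ! i)))"
    proof (intro prod.cong refl)
      fix i assume "i \<in> {..<length l}"
      then have i: "i < length l" by simp
      have "distr M borel (X (fst (l ! i))) = distr M borel (\<lambda>\<omega>. X (t (Suc i)) \<omega> - X (t i) \<omega>)"
        using levy t_nonneg[of i] h(1)[OF i] unfolding levy_process_def step[OF i] by simp
      moreover have "(\<lambda>\<omega>. X (t (Suc i)) \<omega> - X (t i) \<omega>) \<in> borel_measurable M"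
        using X t_nonneg by simp
      ultimately show "prob ((\<lambda>\<omega>. X (t (Suc i)) \<omega> - X (t i) \<omega>) -` snd (l ! i) \<inter> space M)
          = measure (distr M borel (X (fst (l ! i)))) (snd (l ! i))"
        using h[OF i] by (simp add: measure_distr)
    qed
    also have "\<dots> = (\<Prod>(h, A)\<leftarrow>l. measure (distr M borel (X h)) A)"
      by (simp add: prod.list_conv_set_nth case_prod_beta atLeast0LessThan)
    finally show ?thesis .
  qed
qed

text \<open>The prescription of \<^const>\<open>follows\<close> for one unit interval, tested on the dyadic grid of level \<open>m\<close>.\<close>

fun grid :: "nat \<Rightarrow> real set option \<Rightarrow> (real \<times> real set) list" where
  "grid m None = replicate (2 ^ m) (1 / 2 ^ m, {0})"
| "grid m (Some A) = [(1, A)]"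

lemma sum_list_grid: "sum_list (map fst (grid m c)) = 1"
  by (cases c) (auto simp: sum_list_replicate)

lemma incs_grid_None:
  "incs f s (grid m None) \<longleftrightarrow> (\<forall>i\<le>2 ^ m. f (s + real i / 2 ^ m) = f s)"
  by (simp add: incs_replicate_0)

lemma incs_grid_Suc: "incs f s (grid (Suc m) c) \<Longrightarrow> incs f s (grid m c)"
proof (cases c)
  case None
  have "f (s + real i / 2 ^ m) = f s"
    if "\<forall>i\<le>2 ^ Suc m. f (s + real i / 2 ^ Suc m) = f s" "i \<le> 2 ^ m" for i
    using that(1)[rule_format, of "2 * i"] that(2) by simp
  then show "incs f s (grid (Suc m) c) \<Longrightarrow> incs f s (grid m c)"
    unfolding None incs_grid_None by blast
qed simp

lemma incs_concat_grid_Suc: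
  "incs f s (concat (map (grid (Suc m)) l)) \<Longrightarrow> incs f s (concat (map (grid m) l))"
  by (induction l arbitrary: s) (auto simp: incs_append sum_list_grid dest: incs_grid_Suc simp del: grid.simps)

lemma follows_iff_incs: "follows f s l \<longleftrightarrow> (\<forall>m. incs f s (concat (map (grid m) l)))"
proof (induction l arbitrary: s)
  case (Cons c l)
  then show ?case
    by (cases c) (auto simp: incs_append sum_list_grid incs_grid_None simp del: grid.simps(1))
qed simp

lemma grid_concatD:
  assumes "(h, A) \<in> set (concat (map (grid m) l))" and "\<And>B. Some B \<in> set l \<Longrightarrow> B \<in> sets borel"
  shows "0 \<le> h \<and> A \<in> sets borel"
proof -
  obtain c where "c \<in> set l" "(h, A) \<in> set (grid m c)" using assms(1) by auto
  show ?thesis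
  proof (cases c)
    case None
    with \<open>(h, A) \<in> set (grid m c)\<close> show ?thesis by simp
  next
    case (Some B)
    with \<open>(h, A) \<in> set (grid m c)\<close> \<open>c \<in> set l\<close> assms(2)[of B] show ?thesis by simp
  qed
qed

text \<open>Stated for any \<open>f\<close>, because it is needed both on the probability space and on the path space.\<close>

lemma measurable_incs:
  assumes "\<And>t. 0 \<le> t \<Longrightarrow> (\<lambda>\<omega>. f \<omega> t) \<in> borel_measurable N" and "0 \<le> s"
    and "\<And>h A. (h, A) \<in> set l \<Longrightarrow> 0 \<le> h \<and> A \<in> sets borel"
  shows "Measurable.pred N (\<lambda>\<omega>. incs (f \<omega>) s l)"
  using assms(2,3)
proof (induction l arbitrary: s)
  case (Cons p l)
  obtain h A where p: "p = (h, A)" by force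
  have hA: "0 \<le> h" "A \<in> sets borel" using Cons.prems(2)[of h A] p by auto
  have [measurable]: "(\<lambda>\<omega>. f \<omega> (s + h)) \<in> borel_measurable N" "(\<lambda>\<omega>. f \<omega> s) \<in> borel_measurable N"
    using assms(1) Cons.prems(1) hA by auto
  note [measurable] = hA(2)
  have [measurable]: "Measurable.pred N (\<lambda>\<omega>. incs (f \<omega>) (s + h) l)"
    using Cons hA by auto
  show ?case unfolding p incs.simps by measurable
qed simp

lemma measurable_follows:
  assumes "\<And>t. 0 \<le> t \<Longrightarrow> (\<lambda>\<omega>. f \<omega> t) \<in> borel_measurable N" and "0 \<le> s"
    and "\<And>B. Some B \<in> set l \<Longrightarrow> B \<in> sets borel"
  shows "Measurable.pred N (\<lambda>\<omega>. follows (f \<omega>) s l)"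
proof -
  have [measurable]: "Measurable.pred N (\<lambda>\<omega>. incs (f \<omega>) s (concat (map (grid m) l)))" for m
    by (rule measurable_incs) (use assms grid_concatD in auto)
  show ?thesis unfolding follows_iff_incs by measurable
qed

text \<open>Not moving during a unit of time has probability at least \<open>e\<^bsup>-\<lambda>\<^esup>\<close> on every grid, uniformly in
  the mesh, so the lower bound passes to the intersection over all dyadic grids.\<close>

lemma prob_follows_pos:
  assumes cp: "compound_poisson M X \<nu>" and "0 \<le> s"
    and l: "\<And>A. Some A \<in> set l \<Longrightarrow> A \<in> sets borel \<and> 0 < measure (distr M borel (X 1)) A"
  shows "0 < measure M {\<omega> \<in> space M. follows (\<lambda>t. X t \<omega>) s l}"
proof -
  have levy: "levy_process M X"
    using cp by (auto simp: compound_poisson_def characteristic_triplet_def)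
  interpret prob_space M using levy by (simp add: levy_process_def)
  let ?r = "measure \<nu> UNIV"
  define c where "c x = (case x of None \<Rightarrow> exp (- ?r) | Some A \<Rightarrow> measure (distr M borel (X 1)) A)" for x
  define E where "E m = {\<omega> \<in> space M. incs (\<lambda>t. X t \<omega>) s (concat (map (grid m) l))}" for m
  have grid: "c x \<le> (\<Prod>(h, A)\<leftarrow>grid m x. measure (distr M borel (X h)) A)" for x m
  proof (cases x)
    case None
    have "exp (- ?r) = exp (- (1 / 2 ^ m * ?r)) ^ 2 ^ m"
      by (simp add: exp_of_nat_mult[symmetric])
    also have "\<dots> \<le> measure (distr M borel (X (1 / 2 ^ m))) {0} ^ 2 ^ m"
      by (intro power_mono compound_poisson_prob_0_ge[OF cp]) auto
    finally show ?thesis by (simp add: None c_def)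
  next
    case (Some A)
    then show ?thesis by (simp add: c_def)
  qed
  have c_nonneg: "0 \<le> c x" for x by (auto simp: c_def split: option.split)
  have lower: "(\<Prod>x\<leftarrow>l. c x) \<le> prob (E m)" for m
  proof -
    have "(\<Prod>x\<leftarrow>k. c x) \<le> (\<Prod>(h, A)\<leftarrow>concat (map (grid m) k). measure (distr M borel (X h)) A)
        \<and> 0 \<le> (\<Prod>x\<leftarrow>k. c x)" for k
    proof (induction k)
      case (Cons x k)
      have "(\<Prod>x\<leftarrow>x # k. c x) \<le> (\<Prod>(h, A)\<leftarrow>grid m x. measure (distr M borel (X h)) A) *
          (\<Prod>(h, A)\<leftarrow>concat (map (grid m) k). measure (distr M borel (X h)) A)"
        using Cons grid[of x m] c_nonneg[of x] by (simp add: mult_mono')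
      then show ?case using Cons c_nonneg[of x] by simp
    qed simp
    then show ?thesis
      unfolding E_def using l by (subst prob_incs[OF levy \<open>0 \<le> s\<close> grid_concatD]) auto
  qed
  have "E m \<in> events" for m
    unfolding E_def
  proof (rule predE, rule measurable_incs)
    show "X t \<in> borel_measurable M" if "0 \<le> t" for t using levy that by (simp add: levy_process_def)
    show "0 \<le> h \<and> A \<in> sets borel" if "(h, A) \<in> set (concat (map (grid m) l))" for h A
      by (rule grid_concatD[OF that]) (use l in blast)
  qed fact
  moreover have "decseq E"
    unfolding decseq_Suc_iff E_def by (auto dest: incs_concat_grid_Suc)
  ultimately have "(\<lambda>m. prob (E m)) \<longlonglongrightarrow> prob (\<Inter>m. E m)"
    by (intro finite_Lim_measure_decseq) auto
  then have "(\<Prod>x\<leftarrow>l. c x) \<le> prob (\<Inter>m. E m)"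
    using lower by (intro LIMSEQ_le_const) auto
  moreover have "0 < (\<Prod>x\<leftarrow>k. c x)" if "set k \<subseteq> set l" for k
    using that l by (induction k) (auto simp: c_def split: option.split)
  moreover have "(\<Inter>m. E m) = {\<omega> \<in> space M. follows (\<lambda>t. X t \<omega>) s l}"
    by (auto simp: E_def follows_iff_incs)
  ultimately show ?thesis by (metis order_less_le_trans subset_refl)
qed

section \<open>Paths of a compound Poisson process\<close>

text \<open>A dyadic interval of length \<open>h\<close> carries a change with probability at most \<open>1 - e\<^bsup>-\<lambda>h\<^esup> \<le> \<lambda>h\<close>. The expected
  number of changes on \<open>[0, N]\<close> is thus at most \<open>\<lambda>N\<close> on every grid; as the number increases under
  refinement, monotone convergence makes its supremum almost surely finite.\<close>

lemma AE_bounded_changes: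
  assumes cp: "compound_poisson M X \<nu>"
  shows "AE \<omega> in M. \<exists>K. \<forall>m. card (changes (\<lambda>t. X t \<omega>) m (real N)) \<le> K"
proof -
  have levy: "levy_process M X"
    using cp by (auto simp: compound_poisson_def characteristic_triplet_def)
  interpret prob_space M using levy by (simp add: levy_process_def)
  let ?r = "measure \<nu> UNIV"
  have X[measurable]: "X u \<in> borel_measurable M" if "0 \<le> u" for u
    using levy that by (simp add: levy_process_def)
  have [measurable]: "X (real j / 2 ^ m) \<in> borel_measurable M" for j m by (rule X) simp
  define D where "D m j = {\<omega> \<in> space M. X (real (j + 1) / 2 ^ m) \<omega> \<noteq> X (real j / 2 ^ m) \<omega>}" for m j
  have D: "D m j \<in> events" for m j unfolding D_def by measurable
  define c where "c m \<omega> = card (changes (\<lambda>t. X t \<omega>) m (real N))" for m \<omega>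
  have c: "ennreal (c m \<omega>) = (\<Sum>j<N * 2 ^ m. indicator (D m j) \<omega>)" if "\<omega> \<in> space M" for m \<omega>
  proof -
    have "real (j + 1) / 2 ^ m \<le> real N \<longleftrightarrow> j < N * 2 ^ m" for j
    proof -
      have "real (j + 1) / 2 ^ m \<le> real N \<longleftrightarrow> real (j + 1) \<le> real (N * 2 ^ m)"
        by (simp add: field_simps)
      also have "\<dots> \<longleftrightarrow> j < N * 2 ^ m" by (subst of_nat_le_iff) auto
      finally show ?thesis .
    qed
    then have "changes (\<lambda>t. X t \<omega>) m (real N) = {j \<in> {..<N * 2 ^ m}. \<omega> \<in> D m j}"
      using that by (auto simp: changes_def D_def)
    then have "real (c m \<omega>) = (\<Sum>j<N * 2 ^ m. indicator (D m j) \<omega>)"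
      by (simp add: c_def indicator_def sum.If_cases Int_def)
    then show ?thesis by (simp add: ennreal_indicator[symmetric] sum_ennreal del: ennreal_of_nat_eq_real_of_nat)
  qed
  have prob_D: "prob (D m j) \<le> ?r / 2 ^ m" for m j
  proof -
    let ?s = "real j / 2 ^ m" and ?h = "1 / 2 ^ m :: real"
    have "prob {\<omega> \<in> space M. incs (\<lambda>t. X t \<omega>) ?s [(?h, {0})]} = measure (distr M borel (X ?h)) {0}"
      by (subst prob_incs[OF levy]) auto
    also have "{\<omega> \<in> space M. incs (\<lambda>t. X t \<omega>) ?s [(?h, {0})]} = space M - D m j"
      by (auto simp: D_def add_divide_distrib add.commute)
    also have "prob (space M - D m j) = 1 - prob (D m j)" by (rule prob_compl) (rule D)
    finally have "prob (D m j) \<le> 1 - exp (- (?h * ?r))"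
      using compound_poisson_prob_0_ge[OF cp, of ?h] by simp
    also have "\<dots> \<le> ?h * ?r" using exp_ge_add_one_self[of "- (?h * ?r)"] by linarith
    finally show ?thesis by simp
  qed
  have mono: "incseq c"
    unfolding incseq_Suc_iff c_def le_fun_def by (auto intro: card_changes_Suc)
  have meas: "(\<lambda>\<omega>. ennreal (c m \<omega>)) \<in> borel_measurable M" for m
  proof -
    have "(\<lambda>\<omega>. \<Sum>j<N * 2 ^ m. indicator (D m j) \<omega> :: ennreal) \<in> borel_measurable M"
      using D by measurable
    then show ?thesis by (subst measurable_cong[OF c])
  qed
  have bound: "(\<integral>\<^sup>+\<omega>. ennreal (c m \<omega>) \<partial>M) \<le> ennreal (N * ?r)" for m
  proof -
    have "(\<integral>\<^sup>+\<omega>. ennreal (c m \<omega>) \<partial>M) = (\<Sum>j<N * 2 ^ m. emeasure M (D m j))"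
      using D by (subst nn_integral_cong[OF c]) (auto simp: nn_integral_sum)
    also have "\<dots> = ennreal (\<Sum>j<N * 2 ^ m. prob (D m j))"
      by (simp add: emeasure_eq_measure sum_ennreal)
    also have "\<dots> \<le> ennreal (\<Sum>j<N * 2 ^ m. ?r / 2 ^ m)"
      by (intro ennreal_leI sum_mono prob_D)
    finally show ?thesis by simp
  qed
  have "(\<integral>\<^sup>+\<omega>. (SUP m. ennreal (c m \<omega>)) \<partial>M) = (SUP m. \<integral>\<^sup>+\<omega>. ennreal (c m \<omega>) \<partial>M)"
    using mono by (intro nn_integral_monotone_convergence_SUP meas)
      (auto simp: incseq_def le_fun_def intro!: ennreal_leI)
  also have "\<dots> \<le> ennreal (N * ?r)" using bound by (auto intro: SUP_least)
  finally have "(\<integral>\<^sup>+\<omega>. (SUP m. ennreal (c m \<omega>)) \<partial>M) \<noteq> \<infinity>"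
    by (auto simp: top_unique)
  then have "AE \<omega> in M. (SUP m. ennreal (c m \<omega>)) \<noteq> \<infinity>"
    by (intro nn_integral_PInf_AE) (use meas in measurable)
  then show ?thesis
  proof eventually_elim
    case (elim \<omega>)
    then obtain r where r: "(SUP m. ennreal (c m \<omega>)) = ennreal r" "0 \<le> r"
      by (cases "SUP m. ennreal (c m \<omega>)") auto
    have "c m \<omega> \<le> nat \<lceil>r\<rceil>" for m
    proof -
      have "ennreal (c m \<omega>) \<le> ennreal r" unfolding r(1)[symmetric] by (rule SUP_upper) simp
      then have "real (c m \<omega>) \<le> r" using r(2) by (simp only: ennreal_le_iff)
      then show ?thesis by linarith
    qed
    then show ?case unfolding c_def by blast
  qed
qed

lemma AE_locally_step:
  assumes cp: "compound_poisson M X \<nu>"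
  shows "AE \<omega> in M. (\<forall>t\<ge>0. continuous (at_right t) (\<lambda>t. X t \<omega>)) \<and> locally_step (\<lambda>t. X t \<omega>)"
proof -
  have "AE \<omega> in M. cadlag (\<lambda>t. X t \<omega>)"
    using cp by (auto simp: compound_poisson_def characteristic_triplet_def levy_process_def)
  moreover have "AE \<omega> in M. \<forall>N. \<exists>K. \<forall>m. card (changes (\<lambda>t. X t \<omega>) m (real N)) \<le> K"
    unfolding AE_all_countable using AE_bounded_changes[OF cp] by blast
  ultimately show ?thesis
    by eventually_elim (auto simp: cadlag_def intro!: locally_step_if_bounded_changes)
qed

section \<open>Supports of measures on the line\<close>

lemma closed_measure_support: "closed (measure_support \<mu>)"
proof -
  have "- measure_support \<mu> = \<Union>{U. open U \<and> emeasure \<mu> U = 0}"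
    by (auto simp: measure_support_def)
  moreover have "open (\<Union>{U. open U \<and> emeasure \<mu> U = 0})" by (rule open_Union) blast
  ultimately show ?thesis by (simp add: closed_def)
qed

lemma measure_support_Int_open:
  fixes \<mu> :: "'a::second_countable_topology measure"
  assumes "sets \<mu> = sets borel" "open S" "emeasure \<mu> S \<noteq> 0"
  shows "\<exists>x\<in>S. x \<in> measure_support \<mu>"
proof (rule ccontr)
  assume neg: "\<not> ?thesis"
  \<comment> \<open>Otherwise \<open>S\<close> would be covered by null open sets, and countably many of them suffice.\<close>
  let ?F = "{U. open U \<and> U \<subseteq> S \<and> emeasure \<mu> U = 0}"
  obtain F' where F': "F' \<subseteq> ?F" "countable F'" "\<Union>F' = \<Union>?F"
    using Lindelof[of ?F] by auto
  have "S \<subseteq> \<Union>?F"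
  proof
    fix x assume "x \<in> S"
    then obtain U where "open U" "x \<in> U" "emeasure \<mu> U = 0"
      using neg by (auto simp: measure_support_def)
    then have "U \<inter> S \<in> ?F"
      using assms emeasure_mono[of "U \<inter> S" U \<mu>] by (auto simp: open_Int)
    then show "x \<in> \<Union>?F" using \<open>x \<in> S\<close> \<open>x \<in> U\<close> by blast
  qed
  moreover have "\<Union>F' \<in> null_sets \<mu>"
  proof -
    have "U \<in> null_sets \<mu>" if "U \<in> F'" for U
      using that F'(1) assms(1) by (auto simp: null_sets_def)
    then show ?thesis using null_sets_UN'[OF F'(2), of "\<lambda>U. U" \<mu>] by simp
  qed
  ultimately have "emeasure \<mu> S = 0"
    using F'(3) assms emeasure_mono[of S "\<Union>F'" \<mu>] by (auto simp: null_sets_def)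
  with assms(3) show False by simp
qed

lemma measure_support_interval_pos:
  fixes x :: real
  assumes "x \<in> measure_support (distr M borel Y)" "finite_measure M" "Y \<in> borel_measurable M" "d > 0"
  shows "0 < measure (distr M borel Y) {x - d<..<x + d}"
proof -
  interpret finite_measure "distr M borel Y" using assms by (intro finite_measure.finite_measure_distr)
  have "emeasure (distr M borel Y) {x - d<..<x + d} \<noteq> 0"
    using assms(1,4) unfolding measure_support_def
    by (auto dest!: spec[of _ "{x - d<..<x + d}"])
  then show ?thesis by (simp add: emeasure_eq_measure zero_less_measure_iff)
qed

section \<open>Points in the support of the exponential functional\<close>

lemma levy_process_of_compound_poisson: "compound_poisson M X \<nu> \<Longrightarrow> levy_process M X"
  by (auto simp: compound_poisson_def characteristic_triplet_def)

lemma zero_in_support_law: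
  assumes cp: "compound_poisson M X \<nu>"
  shows "0 \<in> measure_support (distr M borel (X 1))"
  unfolding measure_support_def
proof (intro CollectI allI impI)
  fix U :: "real set" assume U: "open U" "0 \<in> U"
  interpret prob_space M using levy_process_of_compound_poisson[OF cp] by (simp add: levy_process_def)
  have "X 1 \<in> borel_measurable M"
    using levy_process_of_compound_poisson[OF cp] by (simp add: levy_process_def)
  then interpret R: real_distribution "distr M borel (X 1)" by (rule real_distribution_distr)
  have "0 < measure (distr M borel (X 1)) {0}"
    using compound_poisson_prob_0_ge[OF cp, of 1] by (simp add: less_le_trans[OF exp_gt_zero])
  also have "\<dots> \<le> measure (distr M borel (X 1)) U" using U by (intro R.finite_measure_mono) auto
  finally show "emeasure (distr M borel (X 1)) U \<noteq> 0" by (simp add: R.emeasure_eq_measure)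
qed

lemma support_levy_measure_subset_law:
  assumes cp: "compound_poisson M X \<nu>"
  shows "measure_support \<nu> \<subseteq> measure_support (distr M borel (X 1))"
  unfolding measure_support_def using levy_measure_null_if[OF cp, of 1] by auto

lemma follows_cong:
  assumes "\<And>t. 0 \<le> t \<Longrightarrow> f t = g t" "0 \<le> s"
  shows "follows f s l \<longleftrightarrow> follows g s l"
  using assms(2)
proof (induction l arbitrary: s)
  case (Cons c l)
  then show ?case by (cases c) (simp_all add: assms(1))
qed simp

text \<open>Both processes follow paths close to the prescribed ones, and \<open>\<tau>\<close> falls into the final interval of
  rest; by independence this event has positive probability, and on it \<open>V\<close> is close to the
  discounted sum of the prescription.\<close>

lemma discounted_sum_in_support:
  assumes "prob_space M"
    and \<xi>: "compound_poisson M \<xi> \<nu>\<^sub>\<xi>" and \<eta>: "compound_poisson M \<eta> \<nu>\<^sub>\<eta>"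
    and indep: "prob_space.indep_var M path_space (sample_path \<xi>) path_space (sample_path \<eta>)"
    and "q > 0" and \<tau>: "distributed M lborel \<tau> (exponential_density q)"
    and indep\<tau>: "prob_space.indep_set M
           (sets (vimage_algebra (space M) \<tau> borel))
           (sets (vimage_algebra (space M) (\<lambda>\<omega>. (sample_path \<xi> \<omega>, sample_path \<eta> \<omega>)) (path_space \<Otimes>\<^sub>M path_space)))"
    and V: "V \<in> borel_measurable M"
    and V_eq: "AE \<omega> in M. V \<omega> =
           stieltjes_integral (\<lambda>s. exp (- left_limit (\<lambda>t. \<xi> t \<omega>) s)) (\<lambda>t. \<eta> t \<omega>) 0 (\<tau> \<omega>)"
    and l: "\<And>b a. (b, a) \<in> set l \<Longrightarrow> b \<in> measure_support (distr M borel (\<eta> 1)) \<and>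
              a \<in> measure_support (distr M borel (\<xi> 1))"
  shows "discounted_sum l \<in> measure_support (distr M borel V)"
  unfolding measure_support_def
proof (intro CollectI allI impI)
  interpret prob_space M by fact
  fix U :: "real set" assume U: "open U" "discounted_sum l \<in> U"
  obtain e where e: "e > 0" "\<And>v. \<bar>v - discounted_sum l\<bar> < e \<Longrightarrow> v \<in> U"
    using U unfolding open_dist dist_real_def by blast
  obtain d where d: "d > 0" "\<And>l'. list_all2 (close d) l l' \<Longrightarrow> \<bar>discounted_sum l' - discounted_sum l\<bar> < e"
    using discounted_sum_continuous[OF e(1)] by blast
  have meas1: "\<xi> 1 \<in> borel_measurable M" "\<eta> 1 \<in> borel_measurable M"
    using levy_process_of_compound_poisson[OF \<xi>] levy_process_of_compound_poisson[OF \<eta>]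
    by (auto simp: levy_process_def)
  have path_event: "{f \<in> space path_space. follows f 0 k} \<in> sets path_space"
    if "\<And>B. Some B \<in> set k \<Longrightarrow> B \<in> sets borel" for k
    by (intro predE measurable_follows) (auto simp: that)
  have prob_path: "0 < prob (sample_path X -` {f \<in> space path_space. follows f 0 k} \<inter> space M)"
    if "compound_poisson M X \<nu>" "\<And>B. Some B \<in> set k \<Longrightarrow> B \<in> sets borel \<and> 0 < measure (distr M borel (X 1)) B"
    for X \<nu> k
  proof -
    have "sample_path X -` {f \<in> space path_space. follows f 0 k} \<inter> space M
        = {\<omega> \<in> space M. follows (\<lambda>t. X t \<omega>) 0 k}"
      by (auto simp: sample_path_def space_PiM follows_cong[of "restrict _ _"])
    then show ?thesis using prob_follows_pos[OF that(1) order_refl that(2)] by simp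
  qed
  let ?Bx = "{f \<in> space path_space. follows f 0 (xi_path d l)}"
  let ?By = "{f \<in> space path_space. follows f 0 (eta_path d l)}"
  have x: "B \<in> sets borel \<and> 0 < measure (distr M borel (\<xi> 1)) B" if "Some B \<in> set (xi_path d l)" for B
  proof -
    from that obtain b a where "(b, a) \<in> set l" "B = {a - d<..<a + d}" by (auto simp: xi_path_def)
    then show ?thesis
      using l measure_support_interval_pos[OF _ finite_measure_axioms meas1(1) d(1)] by auto
  qed
  have y: "B \<in> sets borel \<and> 0 < measure (distr M borel (\<eta> 1)) B" if "Some B \<in> set (eta_path d l)" for B
  proof -
    from that obtain b a where "(b, a) \<in> set l" "B = {b - d<..<b + d}" by (auto simp: eta_path_def)
    then show ?thesis
      using l measure_support_interval_pos[OF _ finite_measure_axioms meas1(2) d(1)] by auto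
  qed
  have Bx: "?Bx \<in> sets path_space" and By: "?By \<in> sets path_space"
    using x y by (auto intro!: path_event)
  let ?n = "2 * real (length l)"
  let ?pair = "\<lambda>\<omega>. (sample_path \<xi> \<omega>, sample_path \<eta> \<omega>)"
  define P where "P = ?pair -` (?Bx \<times> ?By) \<inter> space M"
  define T where "T = \<tau> -` {?n<..?n + 1} \<inter> space M"
  have "prob P = prob (sample_path \<xi> -` ?Bx \<inter> space M) * prob (sample_path \<eta> -` ?By \<inter> space M)"
    unfolding P_def by (rule indep_varD[OF indep Bx By])
  then have P: "0 < prob P"
    using prob_path[OF \<xi> x] prob_path[OF \<eta> y] by simp
  have \<tau>_meas[measurable]: "\<tau> \<in> borel_measurable M" using \<tau> by (simp add: distributed_def)
  have T: "0 < prob T"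
  proof -
    have "prob {\<omega> \<in> space M. ?n < \<tau> \<omega>} = exp (- (?n * q))"
      "prob {\<omega> \<in> space M. ?n + 1 < \<tau> \<omega>} = exp (- ((?n + 1) * q))"
      using exponential_distributedD_gt[OF \<tau> _ \<open>q > 0\<close>] by auto
    moreover have "T = {\<omega> \<in> space M. ?n < \<tau> \<omega>} - {\<omega> \<in> space M. ?n + 1 < \<tau> \<omega>}"
      unfolding T_def by auto
    moreover have "prob ({\<omega> \<in> space M. ?n < \<tau> \<omega>} - {\<omega> \<in> space M. ?n + 1 < \<tau> \<omega>})
        = prob {\<omega> \<in> space M. ?n < \<tau> \<omega>} - prob {\<omega> \<in> space M. ?n + 1 < \<tau> \<omega>}"
      by (intro finite_measure_Diff) auto
    ultimately have "prob T = exp (- (?n * q)) - exp (- ((?n + 1) * q))" by simp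
    then show ?thesis using \<open>q > 0\<close> by simp
  qed
  have "T \<in> sets (vimage_algebra (space M) \<tau> borel)"
    unfolding T_def by (rule in_vimage_algebra) simp
  moreover have "P \<in> sets (vimage_algebra (space M) ?pair (path_space \<Otimes>\<^sub>M path_space))"
    unfolding P_def using Bx By by (intro in_vimage_algebra pair_measureI)
  ultimately have TP: "prob (T \<inter> P) = prob T * prob P"
    by (rule indep_setD[OF indep\<tau>])
  have "AE \<omega> in M. \<xi> 0 \<omega> = 0"
    using levy_process_of_compound_poisson[OF \<xi>] by (simp add: levy_process_def)
  with V_eq AE_locally_step[OF \<xi>] AE_locally_step[OF \<eta>]
  have "AE \<omega> in M. \<omega> \<in> T \<inter> P \<longrightarrow> \<omega> \<in> V -` U \<inter> space M"
  proof eventually_elim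
    case (elim \<omega>)
    show ?case
    proof
      assume \<omega>: "\<omega> \<in> T \<inter> P"
      then have "follows (sample_path \<xi> \<omega>) 0 (xi_path d l)" "follows (sample_path \<eta> \<omega>) 0 (eta_path d l)"
        by (auto simp: P_def)
      then have F: "follows (\<lambda>t. \<xi> t \<omega>) 0 (xi_path d l)" "follows (\<lambda>t. \<eta> t \<omega>) 0 (eta_path d l)"
        by (auto simp: sample_path_def follows_cong[of "restrict _ _"])
      obtain l' where "list_all2 (close d) l l'" "V \<omega> = discounted_sum l'"
        using stieltjes_integral_along_paths[where x="\<lambda>t. \<xi> t \<omega>" and y="\<lambda>t. \<eta> t \<omega>" and t="\<tau> \<omega>", OF _ _ _ _ _ F] elim \<omega>
        by (auto simp: T_def)
      then show "\<omega> \<in> V -` U \<inter> space M" using d(2) e(2) \<omega> by (auto simp: T_def)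
    qed
  qed
  then have "prob (T \<inter> P) \<le> prob (V -` U \<inter> space M)"
    using V U by (intro finite_measure_mono_AE) (auto simp: borel_open)
  then have "0 < prob (V -` U \<inter> space M)" using TP T P by (metis less_le_trans mult_pos_pos)
  then show "emeasure (distr M borel V) U \<noteq> 0"
    using V U by (simp add: emeasure_distr borel_open emeasure_eq_measure)
qed

text \<open>If no value of \<open>X\<close> at a positive rational time lies in \<open>U\<close>, then by right-continuity no
  value at the random time \<open>\<tau>\<close> does.\<close>

lemma support_at_random_time:
  assumes cp: "compound_poisson M X \<nu>" and X\<tau>: "X\<^sub>\<tau> \<in> borel_measurable M"
    and eq: "AE \<omega> in M. X\<^sub>\<tau> \<omega> = X (\<tau> \<omega>) \<omega>" and \<tau>: "AE \<omega> in M. 0 \<le> \<tau> \<omega>"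
  shows "measure_support (distr M borel X\<^sub>\<tau>) \<subseteq> measure_support (distr M borel (X 1))"
  unfolding measure_support_def
proof (intro subsetI CollectI allI impI, elim CollectE)
  fix x :: real and U :: "real set" assume U: "open U" "x \<in> U"
    and x: "\<forall>U. open U \<longrightarrow> x \<in> U \<longrightarrow> emeasure (distr M borel X\<^sub>\<tau>) U \<noteq> 0"
  have levy: "levy_process M X" by (rule levy_process_of_compound_poisson) fact
  have X: "X t \<in> borel_measurable M" if "0 \<le> t" for t using levy that by (simp add: levy_process_def)
  show "emeasure (distr M borel (X 1)) U \<noteq> 0"
  proof
    assume null: "emeasure (distr M borel (X 1)) U = 0"
    have "AE \<omega> in M. X r \<omega> \<notin> U" if "r \<in> \<rat> \<inter> {0<..}" for r
    proof -
      have "emeasure (distr M borel (X r)) U = 0"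
        using compound_poisson_null_time_indep[OF cp, of r 1 U] null that U by auto
      then have "emeasure M (X r -` U \<inter> space M) = 0"
        using X[of r] that U by (simp add: emeasure_distr borel_open)
      then show ?thesis
        using X[of r] that U by (intro AE_I[where N="X r -` U \<inter> space M"]) (auto simp: borel_open)
    qed
    then have "AE \<omega> in M. \<forall>r\<in>\<rat> \<inter> {0<..}. X r \<omega> \<notin> U"
      by (subst AE_ball_countable) (auto intro: countable_Int1 countable_rat)
    then have "AE \<omega> in M. X\<^sub>\<tau> \<omega> \<notin> U"
      using eq \<tau> AE_locally_step[OF cp]
    proof eventually_elim
      case (elim \<omega>)
      show ?case
      proof
        assume "X\<^sub>\<tau> \<omega> \<in> U"
        moreover have "((\<lambda>t. X t \<omega>) \<longlongrightarrow> X (\<tau> \<omega>) \<omega>) (at_right (\<tau> \<omega>))"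
          using elim by (auto simp: continuous_within)
        ultimately have "\<forall>\<^sub>F t in at_right (\<tau> \<omega>). X t \<omega> \<in> U"
          using U elim by (intro topological_tendstoD) auto
        then obtain c where c: "\<tau> \<omega> < c" "\<And>t. \<tau> \<omega> < t \<Longrightarrow> t < c \<Longrightarrow> X t \<omega> \<in> U"
          unfolding eventually_at_right_field by blast
        obtain r where "r \<in> \<rat>" "\<tau> \<omega> < r" "r < c" using Rats_dense_in_real[OF c(1)] by blast
        with c(2)[of r] elim show False by auto
      qed
    qed
    then have "emeasure (distr M borel X\<^sub>\<tau>) U = 0"
      using X\<tau> U by (subst (asm) AE_iff_measurable[where N="X\<^sub>\<tau> -` U \<inter> space M"])
        (auto simp: emeasure_distr borel_open)
    with x U show False by blast
  qed
qed

section \<open>Monotone paths\<close>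

lemma levy_process_uminus:
  assumes "levy_process M X"
  shows "levy_process M (\<lambda>t \<omega>. - X t \<omega>)"
  unfolding levy_process_def
proof (intro conjI allI impI)
  note L = assms[unfolded levy_process_def]
  show "prob_space M" using L by blast
  then interpret prob_space M .
  have X: "X t \<in> borel_measurable M" if "0 \<le> t" for t using L that by blast
  show "(\<lambda>\<omega>. - X t \<omega>) \<in> borel_measurable M" if "0 \<le> t" for t using X[OF that] by simp
  show "AE \<omega> in M. - X 0 \<omega> = 0" using L by simp
  show "AE \<omega> in M. cadlag (\<lambda>t. - X t \<omega>)"
  proof -
    have "AE \<omega> in M. cadlag (\<lambda>t. X t \<omega>)" using L by blast
    then show ?thesis
      by eventually_elim (force simp: cadlag_def intro: continuous_minus tendsto_minus)
  qed
  fix n :: nat and t :: "nat \<Rightarrow> real" assume t: "0 \<le> t 0" "\<forall>i<n. t i \<le> t (Suc i)"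
  then have "indep_vars (\<lambda>_. borel) (\<lambda>i \<omega>. X (t (Suc i)) \<omega> - X (t i) \<omega>) {..<n}"
    using L by blast
  then have "indep_vars (\<lambda>_. borel) (\<lambda>i \<omega>. - (X (t (Suc i)) \<omega> - X (t i) \<omega>)) {..<n}"
    by (rule indep_vars_compose2[where Y="\<lambda>i x. - x"]) auto
  then show "indep_vars (\<lambda>_. borel) (\<lambda>i \<omega>. - X (t (Suc i)) \<omega> - - X (t i) \<omega>) {..<n}"
    by simp
next
  note L = assms[unfolded levy_process_def]
  fix s t :: real assume st: "0 \<le> s" "0 \<le> t"
  have X: "X t \<in> borel_measurable M" if "0 \<le> t" for t using L that by blast
  have [measurable]: "X (s + t) \<in> borel_measurable M" "X s \<in> borel_measurable M" "X t \<in> borel_measurable M"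
    using X st by auto
  have "distr M borel (\<lambda>\<omega>. - (X (s + t) \<omega> - X s \<omega>))
      = distr (distr M borel (\<lambda>\<omega>. X (s + t) \<omega> - X s \<omega>)) borel uminus"
    by (subst distr_distr) (auto simp: comp_def)
  also have "distr M borel (\<lambda>\<omega>. X (s + t) \<omega> - X s \<omega>) = distr M borel (X t)"
    using L st by blast
  also have "distr (distr M borel (X t)) borel uminus = distr M borel (\<lambda>\<omega>. - X t \<omega>)"
    by (subst distr_distr) (auto simp: comp_def)
  finally show "distr M borel (\<lambda>\<omega>. - X (s + t) \<omega> - - X s \<omega>) = distr M borel (\<lambda>\<omega>. - X t \<omega>)"
    by simp
qed

text \<open>By stationarity the increments between rational times are almost surely nonnegative, simultaneously
  for all of them; right-continuity extends this to all times.\<close>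

lemma subordinator_if_nonneg:
  assumes levy: "levy_process M X" and nn: "\<And>t. 0 < t \<Longrightarrow> AE \<omega> in M. 0 \<le> X t \<omega>"
  shows "subordinator M X"
proof -
  note L = levy[unfolded levy_process_def]
  have X: "X t \<in> borel_measurable M" if "0 \<le> t" for t using L that by blast
  have "AE \<omega> in M. X p \<omega> \<le> X q \<omega>" if "0 \<le> p" "p < q" for p q
  proof -
    have [measurable]: "X p \<in> borel_measurable M" "X q \<in> borel_measurable M" "X (q - p) \<in> borel_measurable M"
      using X that by auto
    have "AE x in distr M borel (X (q - p)). 0 \<le> x"
      using nn[of "q - p"] that by (subst AE_distr_iff) auto
    also have "distr M borel (X (q - p)) = distr M borel (\<lambda>\<omega>. X (p + (q - p)) \<omega> - X p \<omega>)"
      using L that by (metis diff_ge_0_iff_ge less_imp_le)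
    finally show ?thesis by (subst (asm) AE_distr_iff) auto
  qed
  then have "AE \<omega> in M. \<forall>p\<in>\<rat>. \<forall>q\<in>\<rat>. 0 \<le> p \<longrightarrow> p < q \<longrightarrow> X p \<omega> \<le> X q \<omega>"
    by (simp add: AE_ball_countable[OF countable_rat] del: AE_conj_iff)
  moreover have "AE \<omega> in M. cadlag (\<lambda>t. X t \<omega>)" using L by blast
  ultimately have "AE \<omega> in M. mono_on {0..} (\<lambda>t. X t \<omega>)"
  proof eventually_elim
    case (elim \<omega>)
    show ?case
    proof (intro mono_onI, rule ccontr)
      fix s t :: real assume st: "s \<in> {0..}" "t \<in> {0..}" "s \<le> t" and neg: "\<not> X s \<omega> \<le> X t \<omega>"
      then have "s < t" by (cases "s = t") auto
      obtain c where c: "X t \<omega> < c" "c < X s \<omega>" using neg dense by (metis not_le)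
      have "((\<lambda>u. X u \<omega>) \<longlongrightarrow> X s \<omega>) (at_right s)" "((\<lambda>u. X u \<omega>) \<longlongrightarrow> X t \<omega>) (at_right t)"
        using elim(2) st by (auto simp: cadlag_def continuous_within)
      then have "\<forall>\<^sub>F u in at_right s. c < X u \<omega>" "\<forall>\<^sub>F u in at_right t. X u \<omega> < c"
        using c by (auto intro: order_tendstoD)
      then obtain e e' where e: "s < e" "\<And>u. s < u \<Longrightarrow> u < e \<Longrightarrow> c < X u \<omega>"
        and e': "t < e'" "\<And>u. t < u \<Longrightarrow> u < e' \<Longrightarrow> X u \<omega> < c"
        unfolding eventually_at_right_field by blast
      obtain p where p: "p \<in> \<rat>" "s < p" "p < min e t"
        using Rats_dense_in_real[of s "min e t"] e(1) \<open>s < t\<close> by auto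
      obtain q where q: "q \<in> \<rat>" "t < q" "q < e'" using Rats_dense_in_real[OF e'(1)] by auto
      have "X p \<omega> \<le> X q \<omega>" using elim(1) p q st by auto
      with e(2)[of p] e'(2)[of q] p q show False by auto
    qed
  qed
  with levy show ?thesis by (simp add: subordinator_def)
qed

lemma subordinator_nonneg:
  assumes "subordinator M X" "0 \<le> t"
  shows "AE \<omega> in M. 0 \<le> X t \<omega>"
proof -
  have "AE \<omega> in M. X 0 \<omega> = 0" "AE \<omega> in M. mono_on {0..} (\<lambda>t. X t \<omega>)"
    using assms by (auto simp: subordinator_def levy_process_def)
  then show ?thesis
  proof eventually_elim
    case (elim \<omega>)
    then show ?case using mono_onD[OF elim(2), of 0 t] \<open>0 \<le> t\<close> by simp
  qed
qed

lemma subordinator_iff_no_negative_jumps: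
  assumes cp: "compound_poisson M X \<nu>"
  shows "subordinator M X \<longleftrightarrow> emeasure \<nu> {..<0} = 0"
proof
  assume sub: "subordinator M X"
  have X: "X 1 \<in> borel_measurable M"
    using levy_process_of_compound_poisson[OF cp] by (simp add: levy_process_def)
  have "AE x in distr M borel (X 1). 0 \<le> x"
    using subordinator_nonneg[OF sub, of 1] X by (subst AE_distr_iff) auto
  then have "emeasure (distr M borel (X 1)) {..<0} = 0"
    by (subst (asm) AE_iff_measurable[where N="{..<0}"]) auto
  then show "emeasure \<nu> {..<0} = 0" by (intro levy_measure_null_if[OF cp, of 1]) auto
next
  assume "emeasure \<nu> {..<0} = 0"
  then have "AE \<omega> in M. X t \<omega> \<in> {0..}" if "0 < t" for t
    using that by (intro compound_poisson_AE_in[OF cp]) (auto simp: Compl_atLeast)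
  then show "subordinator M X"
    by (intro subordinator_if_nonneg levy_process_of_compound_poisson[OF cp]) auto
qed

lemma subordinator_uminus_iff_no_positive_jumps:
  assumes cp: "compound_poisson M X \<nu>"
  shows "subordinator M (\<lambda>t \<omega>. - X t \<omega>) \<longleftrightarrow> emeasure \<nu> {0<..} = 0"
proof
  assume sub: "subordinator M (\<lambda>t \<omega>. - X t \<omega>)"
  have X: "X 1 \<in> borel_measurable M"
    using levy_process_of_compound_poisson[OF cp] by (simp add: levy_process_def)
  have "AE x in distr M borel (X 1). x \<le> 0"
    using subordinator_nonneg[OF sub, of 1] X by (subst AE_distr_iff) auto
  then have "emeasure (distr M borel (X 1)) {0<..} = 0"
    by (subst (asm) AE_iff_measurable[where N="{0<..}"]) auto
  then show "emeasure \<nu> {0<..} = 0" by (intro levy_measure_null_if[OF cp, of 1]) auto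
next
  assume "emeasure \<nu> {0<..} = 0"
  then have "AE \<omega> in M. X t \<omega> \<in> {..0}" if "0 < t" for t
    using that by (intro compound_poisson_AE_in[OF cp]) (auto simp: Compl_atMost)
  then show "subordinator M (\<lambda>t \<omega>. - X t \<omega>)"
    by (intro subordinator_if_nonneg levy_process_uminus levy_process_of_compound_poisson[OF cp]) auto
qed

section \<open>Reachable values\<close>

text \<open>The values that \<open>V\<close> takes along paths whose jumps come from \<open>A\<close> (for \<open>\<xi>\<close>) and \<open>B\<close> (for \<open>\<eta>\<close>), built up
  backwards in time: an earlier jump of \<open>\<eta>\<close> is added undiscounted, and an earlier jump of \<open>\<xi>\<close> rescales
  everything that comes after it.\<close>

inductive reach :: "real set \<Rightarrow> real set \<Rightarrow> real \<Rightarrow> bool" for A B where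
  zero: "reach A B 0"
| jump: "b \<in> B \<Longrightarrow> reach A B v \<Longrightarrow> reach A B (b + v)"
| grow: "a \<in> A \<Longrightarrow> reach A B v \<Longrightarrow> reach A B (exp (- a) * v)"

text \<open>The padding by \<open>0\<close> separates jumps of \<open>\<eta>\<close> and \<open>\<xi>\<close>, which alternate in \<^const>\<open>discounted_sum\<close>.\<close>

lemma reach_discounted_sum:
  assumes "reach A B v"
  shows "\<exists>l. set l \<subseteq> insert 0 B \<times> insert 0 A \<and> v = discounted_sum l"
  using assms
proof induction
  case zero
  show ?case by (intro exI[of _ "[]"]) simp
next
  case (jump b v)
  then obtain l where "set l \<subseteq> insert 0 B \<times> insert 0 A" "v = discounted_sum l" by blast
  with jump show ?case by (intro exI[of _ "(b, 0) # l"]) simp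
next
  case (grow a v)
  then obtain l where "set l \<subseteq> insert 0 B \<times> insert 0 A" "v = discounted_sum l" by blast
  with grow show ?case by (intro exI[of _ "(0, a) # l"]) simp
qed

lemma reach_jumps: "b \<in> B \<Longrightarrow> reach A B v \<Longrightarrow> reach A B (real n * b + v)"
proof (induction n)
  case (Suc n)
  have "reach A B (b + (real n * b + v))" 
    by (rule reach.jump[OF Suc.prems(1) Suc.IH[OF Suc.prems]])
  then show ?case by (simp add: algebra_simps)
qed simp

lemma reach_multiple: "b \<in> B \<Longrightarrow> reach A B (real n * b)"
  using reach_jumps[OF _ reach.zero, of b B A n] by simp

lemma reach_grows: "a \<in> A \<Longrightarrow> reach A B v \<Longrightarrow> reach A B (exp (- (real n * a)) * v)"
proof (induction n)
  case (Suc n)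
  have "reach A B (exp (- a) * (exp (- (real n * a)) * v))" 
    by (rule reach.grow[OF Suc.prems(1) Suc.IH[OF Suc.prems]])
  then show ?case by (simp add: exp_add[symmetric] algebra_simps mult.assoc[symmetric] flip: exp_add)
qed simp

text \<open>The intervals \<open>[np, nq]\<close> overlap from the index \<open>n > p / (q - p)\<close> on.\<close>

lemma interval_multiples_cover:
  fixes p q c :: real
  assumes "0 < p" "p < q" "of_int (\<lfloor>p / (q - p)\<rfloor> + 1) * p \<le> c"
  obtains n :: nat where "0 < n" "p \<le> c / real n" "c / real n \<le> q"
proof -
  define n where "n = nat \<lfloor>c / p\<rfloor>"
  have "of_int (\<lfloor>p / (q - p)\<rfloor> + 1) \<le> c / p" using assms by (simp add: pos_le_divide_eq)
  then have le: "\<lfloor>p / (q - p)\<rfloor> + 1 \<le> \<lfloor>c / p\<rfloor>" by (simp only: le_floor_iff)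
  have "0 \<le> p / (q - p)" using assms by simp
  then have "0 \<le> \<lfloor>p / (q - p)\<rfloor>" by simp
  with le have "1 \<le> \<lfloor>c / p\<rfloor>" by linarith
  then have n: "0 < n" "of_int \<lfloor>c / p\<rfloor> = real n" unfolding n_def by linarith+
  have "p / (q - p) < of_int (\<lfloor>p / (q - p)\<rfloor> + 1)" by linarith
  also have "\<dots> \<le> real n" using le unfolding n(2)[symmetric] by (simp only: of_int_le_iff)
  finally have "p < real n * (q - p)" using assms by (simp add: divide_less_eq)
  moreover have "real n \<le> c / p" "c / p < real n + 1" unfolding n(2)[symmetric] by linarith+
  then have "real n * p \<le> c" "c < (real n + 1) * p"
    using assms by (auto simp: pos_le_divide_eq pos_divide_less_eq)
  ultimately have "p \<le> c / real n" "c / real n \<le> q"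
    using n(1) by (auto simp: field_simps)
  with n(1) show ?thesis by (rule that)
qed

lemma reach_multiple_of_interval:
  assumes "0 < p" "p < q" "of_int (\<lfloor>p / (q - p)\<rfloor> + 1) * p \<le> x" "{p..q} \<subseteq> B"
  shows "reach A B x"
proof -
  obtain n :: nat where n: "0 < n" "p \<le> x / n" "x / n \<le> q"
    by (rule interval_multiples_cover[OF assms(1-3)])
  have "x / n \<in> B" using n(2,3) assms(4) by auto
  then have "reach A B (real n * (x / n))" by (rule reach_multiple)
  then show ?thesis using n(1) by simp
qed

lemma reach_multiple_of_neg_interval:
  assumes "q < p" "p < 0" "x \<le> of_int (\<lfloor>p / (q - p)\<rfloor> + 1) * p" "{q..p} \<subseteq> B"
  shows "reach A B x"
proof -
  have eq: "(- p) / (- q - - p) = p / (q - p)"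
  proof -
    have "- q - - p = - (q - p)" by simp
    then show ?thesis by (simp only: minus_divide_divide)
  qed
  have "of_int (\<lfloor>(- p) / (- q - - p)\<rfloor> + 1) * (- p) \<le> - x"
    unfolding eq using assms(3) by simp
  then obtain n :: nat where n: "0 < n" "- p \<le> - x / n" "- x / n \<le> - q"
    by (rule interval_multiples_cover[rotated 2]) (use assms(1,2) in auto)
  have "x / n \<in> B" using n(2,3) assms(4) by auto
  then have "reach A B (real n * (x / n))" by (rule reach_multiple)
  then show ?thesis using n(1) by simp
qed

text \<open>One jump \<open>b\<close> of \<open>\<eta>\<close> after \<open>n\<close> equal jumps of \<open>\<xi>\<close> reaches \<open>x\<close>, provided that \<open>ln (x / b)\<close> is \<open>n\<close> times a
  number in \<open>[-\<alpha>, -\<beta>]\<close>.\<close>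

lemma reach_grow_interval:
  assumes "\<beta> < \<alpha>" "\<alpha> < 0" "{\<beta>..\<alpha>} \<subseteq> A" and b: "b \<in> B" "b \<noteq> 0"
    and x: "exp (- of_int (\<lfloor>\<alpha> / (\<beta> - \<alpha>)\<rfloor> + 1) * \<alpha>) \<le> x / b"
  shows "reach A B x"
proof -
  have eq: "(- \<alpha>) / (- \<beta> - - \<alpha>) = \<alpha> / (\<beta> - \<alpha>)"
  proof -
    have "- \<beta> - - \<alpha> = - (\<beta> - \<alpha>)" by simp
    then show ?thesis by (simp only: minus_divide_divide)
  qed
  have pos: "0 < x / b" using x by (rule less_le_trans[OF exp_gt_zero])
  have "- of_int (\<lfloor>\<alpha> / (\<beta> - \<alpha>)\<rfloor> + 1) * \<alpha> \<le> ln (x / b)"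
    using x pos by (simp only: ln_ge_iff)
  then have "of_int (\<lfloor>(- \<alpha>) / (- \<beta> - - \<alpha>)\<rfloor> + 1) * (- \<alpha>) \<le> ln (x / b)"
    unfolding eq by (simp add: algebra_simps)
  then obtain n :: nat where n: "0 < n" "- \<alpha> \<le> ln (x / b) / n" "ln (x / b) / n \<le> - \<beta>"
    by (rule interval_multiples_cover[rotated 2]) (use assms(1,2) in auto)
  have "reach A B (exp (- (real n * (- (ln (x / b) / n)))) * (b + 0))"
    by (intro reach_grows reach.jump reach.zero b) (use assms(3) n in auto)
  then show ?thesis using n(1) pos b by simp
qed

text \<open>The condition on \<open>s\<close> says that \<open>e\<^bsup>-s\<^esup> \<le> q / p\<close>, so that the intervals \<open>e\<^bsup>-js\<^esup> [p, q]\<close> leave no gaps.\<close>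

lemma scale_into_interval:
  fixes p q s x :: real
  assumes "s < 0" "0 < p" "0 < q" "- s \<le> ln (q / p)" "p \<le> x"
  shows "\<exists>j::nat. p \<le> exp (real j * s) * x \<and> exp (real j * s) * x \<le> q"
proof -
  define j where "j = nat \<lfloor>ln (x / p) / (- s)\<rfloor>"
  have "0 \<le> ln (x / p) / (- s)" using assms by (intro divide_nonneg_pos) auto
  then have "real j \<le> ln (x / p) / (- s)" "ln (x / p) / (- s) < real j + 1"
    unfolding j_def by linarith+
  moreover have "0 < - s" using assms by simp
  ultimately have j: "real j * (- s) \<le> ln (x / p)" "ln (x / p) < (real j + 1) * (- s)"
    by (simp_all only: pos_le_divide_eq pos_divide_less_eq)
  have ln: "ln (exp (real j * s) * x) = real j * s + ln (x / p) + ln p" "ln (q / p) = ln q - ln p"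
    using assms by (auto simp: ln_mult ln_div)
  have "ln p \<le> ln (exp (real j * s) * x)" "ln (exp (real j * s) * x) \<le> ln q"
    using j assms(4) unfolding ln by (auto simp: algebra_simps)
  then show ?thesis using assms by (intro exI[of _ j]) (auto simp: ln_le_cancel_iff)
qed

lemma reach_scaled:
  assumes "s \<in> A" "exp (real j * s) * x \<in> B"
  shows "reach A B x"
proof -
  have "reach A B (exp (- (real j * s)) * (exp (real j * s) * x + 0))"
    by (intro reach_grows reach.jump reach.zero assms)
  then show ?thesis by (simp add: mult.assoc[symmetric] exp_minus)
qed

lemma exists_nat_mult_ge:
  fixes b y :: real
  assumes "0 < b"
  shows "\<exists>m::nat. y \<le> real m * b"
  using reals_Archimedean3[OF assms] by (meson less_imp_le)

text \<open>By Kronecker's theorem the multiples of \<open>\<theta> = z\<^sub>2 / \<bar>z\<^sub>1\<bar>\<close> are dense modulo one. Applying it to a large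
  multiple of \<open>\<theta>\<close> makes the number of jumps \<open>z\<^sub>1\<close> that is needed nonnegative.\<close>

lemma reach_dense_if_irrational:
  assumes z: "z1 \<in> B" "z2 \<in> B" "z1 < 0" "0 < z2" "z2 / z1 \<notin> \<rat>" and "0 < e"
  shows "\<exists>v. reach A B v \<and> \<bar>v - x\<bar> < e"
proof -
  define th t where "th = z2 / (- z1)" and "t = x / (- z1)"
  have th: "0 < th" unfolding th_def using z by (simp add: divide_pos_neg)
  obtain N :: nat where N: "\<bar>t\<bar> + 1 \<le> real N * th" using exists_nat_mult_ge[OF th] by blast
  then have "N \<noteq> 0" by (intro notI) simp
  have "real N * th \<notin> \<rat>"
  proof
    assume "real N * th \<in> \<rat>"
    then have "- (real N * th / real N) \<in> \<rat>" by (intro Rats_minus_iff[THEN iffD2] Rats_divide) auto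
    then show False using \<open>N \<noteq> 0\<close> z by (simp add: th_def)
  qed
  moreover have "0 \<le> frac t" "frac t \<le> 1" by (auto intro: less_imp_le frac_lt_1)
  moreover have "0 < e / (- z1)" using z \<open>0 < e\<close> by (simp add: divide_pos_neg)
  ultimately obtain k :: nat where k: "0 < k" "\<bar>frac (real k * (real N * th)) - frac t\<bar> < e / (- z1)"
    by (rule Kronecker_approx_1_explicit)
  have "t \<le> real N * th" using N by simp
  also have "\<dots> = 1 * (real N * th)" by simp
  also have "\<dots> \<le> real k * (real N * th)" using k(1) th by (intro mult_right_mono) auto
  finally have "\<lfloor>t\<rfloor> \<le> \<lfloor>real k * (real N * th)\<rfloor>" by (rule floor_mono)
  then obtain n :: nat where n: "\<lfloor>real k * (real N * th)\<rfloor> = \<lfloor>t\<rfloor> + int n"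
    using zle_iff_zadd by metis
  let ?v = "real n * z1 + real (k * N) * z2"
  have "?v - x = (frac (real k * (real N * th)) - frac t) * (- z1)"
  proof -
    have "frac (real k * (real N * th)) - frac t = real k * (real N * th) - t - real n"
      by (simp add: frac_def n)
    moreover have "z2 = th * (- z1)" "x = t * (- z1)" using z by (simp_all add: th_def t_def)
    moreover have "(real k * (real N * th) - t - real n) * (- z1)
        = real n * z1 + real (k * N) * (th * (- z1)) - t * (- z1)"
      by (simp add: algebra_simps)
    ultimately show ?thesis by simp
  qed
  moreover have "\<bar>frac (real k * (real N * th)) - frac t\<bar> * (- z1) < e"
    using k(2) z(3) by (simp only: pos_less_divide_eq neg_0_less_iff_less)
  ultimately have "\<bar>?v - x\<bar> < e" using z by (simp add: abs_mult)
  moreover have "reach A B ?v" by (intro reach_jumps reach_multiple z)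
  ultimately show ?thesis by blast
qed

section \<open>Description of the support in the five cases\<close>

theorem proposition4p4:
  fixes M :: "'a measure"
    and \<xi> \<eta> :: "real \<Rightarrow> 'a \<Rightarrow> real"
    and \<nu>\<^sub>\<xi> \<nu>\<^sub>\<eta> :: "real measure"
    and q :: real
    and \<tau> \<eta>\<^sub>\<tau> V :: "'a \<Rightarrow> real"
  assumes "prob_space M"
    and "compound_poisson M \<xi> \<nu>\<^sub>\<xi>"
    and "compound_poisson M \<eta> \<nu>\<^sub>\<eta>"
    and "prob_space.indep_var M path_space (sample_path \<xi>) path_space (sample_path \<eta>)"
    and "0 \<notin> measure_support \<nu>\<^sub>\<eta>"
    and "0 \<notin> measure_support \<nu>\<^sub>\<xi>"
    and "emeasure \<nu>\<^sub>\<xi> {0..} = 0"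
    and "q > 0"
    and "distributed M lborel \<tau> (exponential_density q)"
    and "prob_space.indep_set M
           (sets (vimage_algebra (space M) \<tau> borel))
           (sets (vimage_algebra (space M) (\<lambda>\<omega>. (sample_path \<xi> \<omega>, sample_path \<eta> \<omega>)) (path_space \<Otimes>\<^sub>M path_space)))"
    and "\<eta>\<^sub>\<tau> \<in> borel_measurable M"
    and "AE \<omega> in M. \<eta>\<^sub>\<tau> \<omega> = \<eta> (\<tau> \<omega>) \<omega>"
    and "V \<in> borel_measurable M"
    and "AE \<omega> in M. V \<omega> =
           stieltjes_integral (\<lambda>s. exp (- left_limit (\<lambda>t. \<xi> t \<omega>) s)) (\<lambda>t. \<eta> t \<omega>) 0 (\<tau> \<omega>)"
  defines "suppV \<equiv> measure_support (distr M borel V)"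
    and "supp\<eta>\<^sub>\<tau> \<equiv> measure_support (distr M borel \<eta>\<^sub>\<tau>)"
    and "supp\<xi> \<equiv> measure_support \<nu>\<^sub>\<xi>"
    and "supp\<eta> \<equiv> measure_support \<nu>\<^sub>\<eta>"
  shows
    "(\<forall>\<alpha> \<beta> :: real. \<beta> < \<alpha> \<longrightarrow> \<alpha> < 0 \<longrightarrow> {\<beta>..\<alpha>} \<subseteq> supp\<xi> \<longrightarrow>
        (let k = \<lfloor>\<alpha> / (\<beta> - \<alpha>)\<rfloor> + 1 in
          (if subordinator M \<eta> then
             supp\<eta>\<^sub>\<tau> \<union> {exp (- of_int k * \<alpha>) * Inf supp\<eta>..}
           else if subordinator M (\<lambda>t \<omega>. - \<eta> t \<omega>) then
             supp\<eta>\<^sub>\<tau> \<union> {..exp (- of_int k * \<alpha>) * Sup supp\<eta>}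
           else UNIV) \<subseteq> suppV))
   \<and> (subordinator M \<eta> \<longrightarrow>
      (\<forall>\<alpha> \<beta> :: real. 0 < \<alpha> \<longrightarrow> \<alpha> < \<beta> \<longrightarrow> {\<alpha>..\<beta>} \<subseteq> supp\<eta> \<longrightarrow>
        (let k = \<lfloor>\<alpha> / (\<beta> - \<alpha>)\<rfloor> + 1 in
          (if ln (\<beta> / \<alpha>) \<ge> - Sup supp\<xi> then {0} \<union> {\<alpha>..}
           else {0} \<union> (\<Union>l\<in>{1..k - 1}. {of_int l * \<alpha>..of_int l * \<beta>}) \<union> {of_int k * \<alpha>..}) \<subseteq> suppV)))
   \<and> (subordinator M (\<lambda>t \<omega>. - \<eta> t \<omega>) \<longrightarrow>
      (\<forall>\<alpha> \<beta> :: real. \<beta> < \<alpha> \<longrightarrow> \<alpha> < 0 \<longrightarrow> {\<beta>..\<alpha>} \<subseteq> supp\<eta> \<longrightarrow>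
        (let k = \<lfloor>\<alpha> / (\<beta> - \<alpha>)\<rfloor> + 1 in
          (if ln (\<beta> / \<alpha>) \<ge> - Sup supp\<xi> then {..\<alpha>} \<union> {0}
           else {..of_int k * \<alpha>} \<union> (\<Union>l\<in>{1..k - 1}. {of_int l * \<beta>..of_int l * \<alpha>}) \<union> {0}) \<subseteq> suppV)))
   \<and> (emeasure \<nu>\<^sub>\<eta> {..0} \<noteq> 0 \<longrightarrow> emeasure \<nu>\<^sub>\<eta> {0..} \<noteq> 0 \<longrightarrow>
      (\<exists>\<alpha> \<beta> :: real. (0 < \<alpha> \<and> \<alpha> < \<beta> \<and> {\<alpha>..\<beta>} \<subseteq> supp\<eta>) \<or>
                      (\<beta> < \<alpha> \<and> \<alpha> < 0 \<and> {\<beta>..\<alpha>} \<subseteq> supp\<eta>)) \<longrightarrow>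
      suppV = UNIV)
   \<and> (emeasure \<nu>\<^sub>\<eta> {..0} \<noteq> 0 \<longrightarrow> emeasure \<nu>\<^sub>\<eta> {0..} \<noteq> 0 \<longrightarrow>
      (\<exists>z\<^sub>1\<in>supp\<eta>. \<exists>z\<^sub>2\<in>supp\<eta>. z\<^sub>1 < 0 \<and> 0 < z\<^sub>2 \<and> z\<^sub>2 / z\<^sub>1 \<notin> \<rat>) \<longrightarrow>
      suppV = UNIV)"
proof -
  interpret prob_space M by fact
  note \<xi> = assms(2) and \<eta> = assms(3)
  have sets: "sets \<nu>\<^sub>\<xi> = sets borel" "sets \<nu>\<^sub>\<eta> = sets borel" "emeasure \<nu>\<^sub>\<xi> UNIV \<noteq> 0"
    "emeasure \<nu>\<^sub>\<eta> UNIV \<noteq> 0" "emeasure \<nu>\<^sub>\<eta> {0} = 0"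
    using \<xi> \<eta> by (auto simp: compound_poisson_def characteristic_triplet_def levy_measure_def)
  have closed: "closed suppV" "closed supp\<xi>" "closed supp\<eta>"
    unfolding suppV_def supp\<xi>_def supp\<eta>_def by (rule closed_measure_support)+
  have sum_V: "discounted_sum l \<in> suppV"
    if "set l \<subseteq> measure_support (distr M borel (\<eta> 1)) \<times> measure_support (distr M borel (\<xi> 1))" for l
    unfolding suppV_def
    by (rule discounted_sum_in_support[OF assms(1-4,8-10,13,14)]) (use that in auto)
  have reach_V: "v \<in> suppV" if "reach supp\<xi> supp\<eta> v" for v
    using reach_discounted_sum[OF that] sum_V zero_in_support_law[OF \<xi>] zero_in_support_law[OF \<eta>]
      support_levy_measure_subset_law[OF \<xi>] support_levy_measure_subset_law[OF \<eta>]
    unfolding supp\<xi>_def supp\<eta>_def by blast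
  have "AE \<omega> in M. 0 \<le> \<tau> \<omega>"
  proof -
    have "prob {\<omega> \<in> space M. 0 < \<tau> \<omega>} = 1"
      using exponential_distributedD_gt[OF assms(9) order_refl assms(8)] by simp
    moreover have "\<tau> \<in> borel_measurable M" using assms(9) by (simp add: distributed_def)
    ultimately have "AE \<omega> in M. 0 < \<tau> \<omega>" using prob_Collect_eq_1[of "\<lambda>\<omega>. 0 < \<tau> \<omega>"] by auto
    then show ?thesis by eventually_elim simp
  qed
  then have "supp\<eta>\<^sub>\<tau> \<subseteq> measure_support (distr M borel (\<eta> 1))"
    unfolding supp\<eta>\<^sub>\<tau>_def by (rule support_at_random_time[OF \<eta> assms(11,12)])
  then have \<eta>\<^sub>\<tau>_V: "supp\<eta>\<^sub>\<tau> \<subseteq> suppV"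
    using sum_V[of "[(_, 0)]"] zero_in_support_law[OF \<xi>] by auto
  have \<xi>_neg: "a < 0" if "a \<in> supp\<xi>" for a
  proof (rule ccontr)
    assume "\<not> a < 0"
    moreover have "a \<noteq> 0" using that assms(6) unfolding supp\<xi>_def by blast
    ultimately have "open {0::real<..}" "a \<in> {0<..}" by auto
    then have "emeasure \<nu>\<^sub>\<xi> {0<..} \<noteq> 0" using that unfolding supp\<xi>_def measure_support_def by blast
    moreover have "emeasure \<nu>\<^sub>\<xi> {0<..} \<le> emeasure \<nu>\<^sub>\<xi> {0..}"
      using sets(1) by (intro emeasure_mono) auto
    ultimately show False using assms(7) by simp
  qed
  have "\<exists>a. a \<in> supp\<xi>"
    using measure_support_Int_open[OF sets(1) open_UNIV sets(3)] by (auto simp: supp\<xi>_def)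
  moreover have "bdd_above supp\<xi>" using \<xi>_neg by (intro bdd_aboveI[of _ 0]) (auto intro: less_imp_le)
  ultimately have Sup\<xi>: "Sup supp\<xi> \<in> supp\<xi>"
    by (intro closed_contains_Sup closed(2)) auto
  note Sup\<xi> = this \<xi>_neg[OF this]
  have pos: "\<exists>b\<in>supp\<eta>. 0 < b" if "emeasure \<nu>\<^sub>\<eta> {0<..} \<noteq> 0"
    using measure_support_Int_open[OF sets(2) _ that] by (auto simp: supp\<eta>_def)
  have neg: "\<exists>b\<in>supp\<eta>. b < 0" if "emeasure \<nu>\<^sub>\<eta> {..<0} \<noteq> 0"
    using measure_support_Int_open[OF sets(2) _ that] by (auto simp: supp\<eta>_def)
  have "\<exists>b. b \<in> supp\<eta>"
    using measure_support_Int_open[OF sets(2) open_UNIV sets(4)] by (auto simp: supp\<eta>_def)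
  then have ne: "supp\<eta> \<noteq> {}" by blast
  have neg': "\<exists>b\<in>supp\<eta>. b < 0" if "emeasure \<nu>\<^sub>\<eta> {..0} \<noteq> 0"
  proof (rule neg)
    have "emeasure \<nu>\<^sub>\<eta> {..0} \<le> emeasure \<nu>\<^sub>\<eta> {..<0} + emeasure \<nu>\<^sub>\<eta> {0}"
      using sets(2) by (subst ivl_disj_un(2)[symmetric]) (intro emeasure_subadditive; auto)
    with that sets(5) show "emeasure \<nu>\<^sub>\<eta> {..<0} \<noteq> 0" by auto
  qed
  have pos': "\<exists>b\<in>supp\<eta>. 0 < b" if "emeasure \<nu>\<^sub>\<eta> {0..} \<noteq> 0"
  proof (rule pos)
    have "{0::real..} = {0} \<union> {0<..}" by auto
    then have "emeasure \<nu>\<^sub>\<eta> {0..} \<le> emeasure \<nu>\<^sub>\<eta> {0} + emeasure \<nu>\<^sub>\<eta> {0<..}"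
      using sets(2) emeasure_subadditive[of "{0}" \<nu>\<^sub>\<eta> "{0<..}"] by simp
    with that sets(5) show "emeasure \<nu>\<^sub>\<eta> {0<..} \<noteq> 0" by auto
  qed
  have Inf\<eta>: "Inf supp\<eta> \<in> supp\<eta>" "0 < Inf supp\<eta>" if "subordinator M \<eta>"
  proof -
    have "0 \<le> b" if "b \<in> supp\<eta>" for b
    proof (rule ccontr)
      assume "\<not> 0 \<le> b"
      then have "open {..<0::real}" "b \<in> {..<0}" by auto
      then have "emeasure \<nu>\<^sub>\<eta> {..<0} \<noteq> 0" using that unfolding supp\<eta>_def measure_support_def by blast
      then show False
        using subordinator_iff_no_negative_jumps[OF \<eta>] \<open>subordinator M \<eta>\<close> by blast
    qed
    then have b: "0 < b" if "b \<in> supp\<eta>" for b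
      using that assms(5) unfolding supp\<eta>_def by (metis order_less_le)
    then show "Inf supp\<eta> \<in> supp\<eta>"
      by (intro closed_contains_Inf ne closed(3) bdd_belowI[of _ 0]) (auto intro: less_imp_le)
    then show "0 < Inf supp\<eta>" by (rule b)
  qed
  have Sup\<eta>: "Sup supp\<eta> \<in> supp\<eta>" "Sup supp\<eta> < 0" if "subordinator M (\<lambda>t \<omega>. - \<eta> t \<omega>)"
  proof -
    have "b \<le> 0" if "b \<in> supp\<eta>" for b
    proof (rule ccontr)
      assume "\<not> b \<le> 0"
      then have "open {0::real<..}" "b \<in> {0<..}" by auto
      then have "emeasure \<nu>\<^sub>\<eta> {0<..} \<noteq> 0" using that unfolding supp\<eta>_def measure_support_def by blast
      then show False
        using subordinator_uminus_iff_no_positive_jumps[OF \<eta>]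
          \<open>subordinator M (\<lambda>t \<omega>. - \<eta> t \<omega>)\<close> by blast
    qed
    then have b: "b < 0" if "b \<in> supp\<eta>" for b
      using that assms(5) unfolding supp\<eta>_def by (metis order_less_le)
    then show "Sup supp\<eta> \<in> supp\<eta>"
      by (intro closed_contains_Sup ne closed(3) bdd_aboveI[of _ 0]) (auto intro: less_imp_le)
    then show "Sup supp\<eta> < 0" by (rule b)
  qed
  show ?thesis
  proof (intro conjI allI impI)
    fix \<alpha> \<beta> :: real assume ab: "\<beta> < \<alpha>" "\<alpha> < 0" "{\<beta>..\<alpha>} \<subseteq> supp\<xi>"
    define k where "k = \<lfloor>\<alpha> / (\<beta> - \<alpha>)\<rfloor> + 1"
    have r: "x \<in> suppV" if "b \<in> supp\<eta>" "b \<noteq> 0" "exp (- of_int k * \<alpha>) \<le> x / b" for x b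
      using that unfolding k_def by (intro reach_V reach_grow_interval[OF ab])
    have 1: "supp\<eta>\<^sub>\<tau> \<union> {exp (- of_int k * \<alpha>) * Inf supp\<eta>..} \<subseteq> suppV" if "subordinator M \<eta>"
      using \<eta>\<^sub>\<tau>_V r[of "Inf supp\<eta>"] Inf\<eta>[OF that] by (auto simp: pos_le_divide_eq)
    have 2: "supp\<eta>\<^sub>\<tau> \<union> {..exp (- of_int k * \<alpha>) * Sup supp\<eta>} \<subseteq> suppV"
      if "subordinator M (\<lambda>t \<omega>. - \<eta> t \<omega>)"
      using \<eta>\<^sub>\<tau>_V r[of "Sup supp\<eta>"] Sup\<eta>[OF that] by (auto simp: neg_le_divide_eq)
    \<comment> \<open>Negative jumps \<open>b\<close> first move the target up into the half-line that is reached through \<open>c\<close>.\<close>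
    have 3: "x \<in> suppV" if sub: "\<not> subordinator M \<eta>" "\<not> subordinator M (\<lambda>t \<omega>. - \<eta> t \<omega>)" for x
    proof -
      obtain b c where bc: "b \<in> supp\<eta>" "b < 0" "c \<in> supp\<eta>" "0 < c"
        using neg pos sub subordinator_iff_no_negative_jumps[OF \<eta>]
          subordinator_uminus_iff_no_positive_jumps[OF \<eta>] by blast
      obtain m :: nat where "exp (- of_int k * \<alpha>) * c - x \<le> real m * (- b)"
        using exists_nat_mult_ge[of "- b"] bc by auto
      then have "exp (- of_int k * \<alpha>) \<le> (x - real m * b) / c" using bc by (simp add: pos_le_divide_eq)
      then have "reach supp\<xi> supp\<eta> (x - real m * b)"
        unfolding k_def using bc by (intro reach_grow_interval[OF ab]) auto
      then have "reach supp\<xi> supp\<eta> (real m * b + (x - real m * b))" by (intro reach_jumps bc)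
      then show ?thesis using reach_V by simp
    qed
    show "let k = \<lfloor>\<alpha> / (\<beta> - \<alpha>)\<rfloor> + 1 in
          (if subordinator M \<eta> then
             supp\<eta>\<^sub>\<tau> \<union> {exp (- of_int k * \<alpha>) * Inf supp\<eta>..}
           else if subordinator M (\<lambda>t \<omega>. - \<eta> t \<omega>) then
             supp\<eta>\<^sub>\<tau> \<union> {..exp (- of_int k * \<alpha>) * Sup supp\<eta>}
           else UNIV) \<subseteq> suppV"
      unfolding Let_def k_def[symmetric] using 1 2 3 by auto
  next
    fix \<alpha> \<beta> :: real assume ab: "0 < \<alpha>" "\<alpha> < \<beta>" "{\<alpha>..\<beta>} \<subseteq> supp\<eta>"
    have 0: "0 \<in> suppV" by (intro reach_V reach.zero)
    have 1: "x \<in> suppV" if x: "- Sup supp\<xi> \<le> ln (\<beta> / \<alpha>)" "\<alpha> \<le> x" for x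
    proof -
      obtain j :: nat where "exp (real j * Sup supp\<xi>) * x \<in> {\<alpha>..\<beta>}"
        using scale_into_interval[OF Sup\<xi>(2) ab(1) _ x] ab by auto
      then show ?thesis using ab by (intro reach_V reach_scaled[OF Sup\<xi>(1)]) auto
    qed
    have 2: "x \<in> suppV" if "1 \<le> l" "of_int l * \<alpha> \<le> x" "x \<le> of_int l * \<beta>" for x and l :: int
    proof -
      have "x / real (nat l) \<in> {\<alpha>..\<beta>}" using that by (auto simp: field_simps)
      then have "reach supp\<xi> supp\<eta> (real (nat l) * (x / real (nat l)))"
        using ab by (intro reach_multiple) auto
      then show ?thesis using that reach_V by simp
    qed
    have 3: "x \<in> suppV" if "of_int (\<lfloor>\<alpha> / (\<beta> - \<alpha>)\<rfloor> + 1) * \<alpha> \<le> x" for x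
      by (intro reach_V reach_multiple_of_interval[OF ab(1,2) that ab(3)])
    show "let k = \<lfloor>\<alpha> / (\<beta> - \<alpha>)\<rfloor> + 1 in
          (if ln (\<beta> / \<alpha>) \<ge> - Sup supp\<xi> then {0} \<union> {\<alpha>..}
           else {0} \<union> (\<Union>l\<in>{1..k - 1}. {of_int l * \<alpha>..of_int l * \<beta>}) \<union> {of_int k * \<alpha>..}) \<subseteq> suppV"
      unfolding Let_def using 0 1 2 3 by auto
  next
    fix \<alpha> \<beta> :: real assume ab: "\<beta> < \<alpha>" "\<alpha> < 0" "{\<beta>..\<alpha>} \<subseteq> supp\<eta>"
    have 0: "0 \<in> suppV" by (intro reach_V reach.zero)
    have 1: "x \<in> suppV" if x: "- Sup supp\<xi> \<le> ln (\<beta> / \<alpha>)" "x \<le> \<alpha>" for x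
    proof -
      have "- Sup supp\<xi> \<le> ln (- \<beta> / - \<alpha>)" using x by simp
      then obtain j :: nat where "exp (real j * Sup supp\<xi>) * x \<in> {\<beta>..\<alpha>}"
        using scale_into_interval[OF Sup\<xi>(2), of "- \<alpha>" "- \<beta>" "- x"] ab x by auto
      then show ?thesis using ab by (intro reach_V reach_scaled[OF Sup\<xi>(1)]) auto
    qed
    have 2: "x \<in> suppV" if "1 \<le> l" "of_int l * \<beta> \<le> x" "x \<le> of_int l * \<alpha>" for x and l :: int
    proof -
      have "x / real (nat l) \<in> {\<beta>..\<alpha>}" using that by (auto simp: field_simps)
      then have "reach supp\<xi> supp\<eta> (real (nat l) * (x / real (nat l)))"
        using ab by (intro reach_multiple) auto
      then show ?thesis using that reach_V by simp
    qed
    have 3: "x \<in> suppV" if "x \<le> of_int (\<lfloor>\<alpha> / (\<beta> - \<alpha>)\<rfloor> + 1) * \<alpha>" for x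
      by (intro reach_V reach_multiple_of_neg_interval[OF ab(1,2) that ab(3)])
    show "let k = \<lfloor>\<alpha> / (\<beta> - \<alpha>)\<rfloor> + 1 in
          (if ln (\<beta> / \<alpha>) \<ge> - Sup supp\<xi> then {..\<alpha>} \<union> {0}
           else {..of_int k * \<alpha>} \<union> (\<Union>l\<in>{1..k - 1}. {of_int l * \<beta>..of_int l * \<alpha>}) \<union> {0}) \<subseteq> suppV"
      unfolding Let_def using 0 1 2 3 by auto
  next
    assume "emeasure \<nu>\<^sub>\<eta> {..0} \<noteq> 0" "emeasure \<nu>\<^sub>\<eta> {0..} \<noteq> 0"
    then obtain b c where bc: "b \<in> supp\<eta>" "b < 0" "c \<in> supp\<eta>" "0 < c" using neg' pos' by blast
    assume "\<exists>\<alpha> \<beta> :: real. (0 < \<alpha> \<and> \<alpha> < \<beta> \<and> {\<alpha>..\<beta>} \<subseteq> supp\<eta>) \<or>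
                      (\<beta> < \<alpha> \<and> \<alpha> < 0 \<and> {\<beta>..\<alpha>} \<subseteq> supp\<eta>)"
    then obtain \<alpha> \<beta> :: real where "(0 < \<alpha> \<and> \<alpha> < \<beta> \<and> {\<alpha>..\<beta>} \<subseteq> supp\<eta>) \<or>
                      (\<beta> < \<alpha> \<and> \<alpha> < 0 \<and> {\<beta>..\<alpha>} \<subseteq> supp\<eta>)" by blast
    \<comment> \<open>Multiples of the interval cover a half-line; jumps of the other sign shift the target into it.\<close>
    then have "reach supp\<xi> supp\<eta> x" for x
    proof
      assume ab: "0 < \<alpha> \<and> \<alpha> < \<beta> \<and> {\<alpha>..\<beta>} \<subseteq> supp\<eta>"
      obtain m :: nat where "of_int (\<lfloor>\<alpha> / (\<beta> - \<alpha>)\<rfloor> + 1) * \<alpha> - x \<le> real m * (- b)"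
        using exists_nat_mult_ge[of "- b"] bc by auto
      then have "reach supp\<xi> supp\<eta> (x - real m * b)"
        using ab by (intro reach_multiple_of_interval[of \<alpha> \<beta>]) auto
      then have "reach supp\<xi> supp\<eta> (real m * b + (x - real m * b))" by (intro reach_jumps bc)
      then show ?thesis by simp
    next
      assume ab: "\<beta> < \<alpha> \<and> \<alpha> < 0 \<and> {\<beta>..\<alpha>} \<subseteq> supp\<eta>"
      obtain m :: nat where "x - of_int (\<lfloor>\<alpha> / (\<beta> - \<alpha>)\<rfloor> + 1) * \<alpha> \<le> real m * c"
        using exists_nat_mult_ge[of c] bc by auto
      then have "reach supp\<xi> supp\<eta> (x - real m * c)"
        using ab by (intro reach_multiple_of_neg_interval[of \<beta> \<alpha>]) auto
      then have "reach supp\<xi> supp\<eta> (real m * c + (x - real m * c))" by (intro reach_jumps bc)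
      then show ?thesis by simp
    qed
    then show "suppV = UNIV" using reach_V by auto
  next
    assume "\<exists>z\<^sub>1\<in>supp\<eta>. \<exists>z\<^sub>2\<in>supp\<eta>. z\<^sub>1 < 0 \<and> 0 < z\<^sub>2 \<and> z\<^sub>2 / z\<^sub>1 \<notin> \<rat>"
    then obtain z1 z2 where z: "z1 \<in> supp\<eta>" "z2 \<in> supp\<eta>" "z1 < 0" "0 < z2" "z2 / z1 \<notin> \<rat>" by blast
    have "x \<in> closure suppV" for x
      unfolding closure_approachable dist_real_def
      using reach_dense_if_irrational[OF z] reach_V by blast
    then show "suppV = UNIV" using closed(1) by auto
  qed
qed

end
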